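(* Each of the seven relations $\preceq_+$, $\preceq_{\mathrm{sto}}$, $\preceq_C$, $\preceq_{C,+}$, $\preceq_{+,\mathrm{sto}}$, $\preceq_{C,\mathrm{sto}}$, $\preceq_{C,+,\mathrm{sto}}$ on $\mathcal M$ is antisymmetric and transitive, hence a partial order. Moreover, let $n\in\{2,3\}$ and let $r_1,\dots,r_n$ be distinct elements of $\{+,\mathrm{sto},C\}$ (in any order). (i) If $\mu_0,\dots,\mu_n\in\mathcal M$ satisfy $\mu_{i-1}\preceq_{r_i}\mu_i$ for $i=1,\dots,n$, then $\mu_0\preceq_{r_1,\dots,r_n}\mu_n$. (ii) Conversely, if $\mu_0,\mu_n\in\mathcal M$ satisfy $\mu_0\preceq_{r_1,\dots,r_n}\mu_n$, then there exist intermediate measures in $\mathcal M$ completing them to a sequence $(\mu_i)_{i=0,\dots,n}$ such that $\mu_{i-1}\preceq_{r_i}\mu_i$ for every $i=1,\dots,n$.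
   Context: $\mathcal M$ is the set of finite positive Borel measures on $\mathbb R$ with finite first moment. Consider (Borel) functions $\varphi:\mathbb R\to\mathbb R$ growing at most linearly at $-\infty$ and $+\infty$; among them let $E_+$ be the non-negative functions, $E_{\mathrm{sto}}$ the non-decreasing functions and $E_C$ the convex functions. For a set $E$ of such functions and $\mu,\nu\in\mathcal M$, let $P(E)$ be the property: $\int\varphi\,d\mu\le\int\varphi\,d\nu$ for all $\varphi\in E$. For a non-empty set $\{r_1,\dots,r_n\}\subset\{+,\mathrm{sto},C\}$, write $\mu\preceq_{r_1,\dots,r_n}\nu$ if $P(E_{r_1}\cap\dots\cap E_{r_n})$ holds. The order in which the subscripts are written does not change the relation (so e.g. $\preceq_{+,\mathrm{sto},C}$ is the same relation as $\preceq_{C,+,\mathrm{sto}}$), but in the theorem it determines the order of the chain. *)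

theory Defs
  imports "HOL-Analysis.Analysis"
begin

definition finite_first_moment_measures :: "real measure set" (\<open>\<M>\<close>) where
  "\<M> = {\<mu>. sets \<mu> = sets borel \<and> finite_measure \<mu> \<and> integrable \<mu> (\<lambda>x. \<bar>x\<bar>)}"

(* The bound is imposed on the whole line, not only near the two infinities. Monotone and
   convex functions are locally bounded, so nothing changes for them; for the others it
   excludes local blow-up, so that every test function is integrable against every measure
   in \<M>, and the Bochner integral (0 for non-integrable functions) is the intended one. *)
definition linear_growth_functions :: "(real \<Rightarrow> real) set" where
  "linear_growth_functions =
     {\<phi> \<in> borel_measurable borel. \<exists>c. \<forall>x. \<bar>\<phi> x\<bar> \<le> c * (1 + \<bar>x\<bar>)}"

datatype order_kind = Nonneg | Sto | Cvx

fun test_functions :: "order_kind \<Rightarrow> (real \<Rightarrow> real) set" where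
  "test_functions Nonneg = {\<phi> \<in> linear_growth_functions. \<forall>x. 0 \<le> \<phi> x}"
| "test_functions Sto = {\<phi> \<in> linear_growth_functions. mono \<phi>}"
| "test_functions Cvx = {\<phi> \<in> linear_growth_functions. convex_on UNIV \<phi>}"

(* The subscripts form a set R, since their order does not matter. Only R \<noteq> {} is meaningful. *)
definition preceq :: "order_kind set \<Rightarrow> real measure \<Rightarrow> real measure \<Rightarrow> bool" where
  "preceq R \<mu> \<nu> \<longleftrightarrow>
     (\<forall>\<phi> \<in> (\<Inter>r\<in>R. test_functions r). (\<integral>x. \<phi> x \<partial>\<mu>) \<le> (\<integral>x. \<phi> x \<partial>\<nu>))"

definition preceq_rel :: "order_kind set \<Rightarrow> (real measure \<times> real measure) set" where
  "preceq_rel R = {(\<mu>, \<nu>). \<mu> \<in> \<M> \<and> \<nu> \<in> \<M> \<and> preceq R \<mu> \<nu>}"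

end

theory Submission
  imports Defs
begin

text \<open>
  A measure with finite first moment is governed by its call function
  $k \mapsto \int (y - k)^+ \, d\mu(y)$, its mass $m$ and its mean $b$. The call functions are
  exactly the convex functions $C$ with $C(k) \to 0$ at $+\infty$ and $C(k) + m k \to b$ at $-\infty$
  (\<open>convex_call\<close>, \<open>call_at_top\<close>, \<open>call_at_bot\<close>, and conversely \<open>measure_of_call\<close>), and $C$ determines
  $\mu$ (\<open>measure_eq_of_call_eq\<close>). The hockey stick $y \mapsto (y - k)^+$ is at once non-negative,
  non-decreasing and convex, so each of the seven relations forces an inequality of call functions.
  That gives antisymmetry; transitivity and the composition of chains are immediate.
  
  The three basic relations are read off from simple data: $\mu \preceq_+ \nu$ when $\nu$ arises from
  $\mu$ by adding a measure; $\mu \preceq_{\mathrm{sto}} \nu$ when the masses agree and the tails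
  $\mu(k, \infty)$ are ordered, for instance because the difference of call functions is non-increasing
  (\<open>preceq_StoI\<close>, \<open>tail_le_of_call_diff_antimono\<close>); $\mu \preceq_C \nu$ when mass and mean agree and
  the call functions are ordered (\<open>preceq_CvxI\<close>).
  
  Splitting a relation with two subscripts thus becomes a problem about tails or convex functions. Write
  $D = C_\nu - C_\mu$ and $\delta$ and $\beta$ for the differences of the masses and the means.
  \<^item> For $+$ and sto, cut $\nu$ into a bottom part of mass $\delta$ and a top part. Put the bottom part
    onto $\mu$, or take the top part as the intermediate measure (\<open>preceq_Nonneg_Sto_factor\<close>).
  \<^item> For $+$ and $C$, one has $W \le D$ with $W(k) = (\beta - \delta k)^+$. Adding to $\mu$ the measure with
    call function $W$ settles one order. For the other, remove from $\nu$ the measure whose call function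
    is the convex hull $H$ of $D$; what remains has call function $C_\nu - H$, and the point is that this is
    again convex (\<open>complement_of_hull_convex\<close>).
  \<^item> For sto and $C$, the intermediate call function is $\max(C_\mu(k), b_\nu - m k)$ in one order. In the
    other it is $C_\nu$ minus the running infimum of $D$, which is again convex
    (\<open>complement_of_running_infimum_convex\<close>).
  
  Hence $\preceq_{r,s}$ is the relational product of $\preceq_r$ and $\preceq_s$ in either order, so that
  the three basic relations commute (\<open>preceq_rel_pair\<close>). For three subscripts it is therefore enough to
  factor in one order: mass placed far enough to the left brings $\mu$ up to the mass of $\nu$ without
  destroying $C_\mu \le C_\nu$ (\<open>add_mass_far_left\<close>), and then the factorization for sto and $C$ applies.
\<close>

section \<open>Convex functions on the real line\<close>

text \<open>
  This lemma and its converse below express convexity through affine upper bounds at two points. In this form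
  inequalities for a function that is pieced together from several others can be chased along a fixed line,
  without computing with convex coefficients.
\<close>

lemma convex_on_le_affine:
  fixes f :: "real \<Rightarrow> real"
  assumes f: "convex_on UNIV f" and "u \<le> z" "z \<le> w"
    and u: "f u \<le> a + b * u" and w: "f w \<le> a + b * w"
  shows "f z \<le> a + b * z"
proof (cases "u = w")
  case True
  then show ?thesis using assms by auto
next
  case False
  define t where "t = (z - u) / (w - u)"
  have "t * (w - u) = z - u" and t: "0 \<le> t" "t \<le> 1"
    using assms False by (auto simp: t_def)
  then have z: "z = (1 - t) * u + t * w"
    by (simp add: algebra_simps)
  have "f z \<le> (1 - t) * f u + t * f w"
    using convex_onD[OF f t(1,2), of u w] z by simp
  also have "\<dots> \<le> (1 - t) * (a + b * u) + t * (a + b * w)"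
    using t u w by (intro add_mono mult_left_mono) auto
  also have "\<dots> = a + b * z"
    by (simp add: z algebra_simps)
  finally show ?thesis .
qed

lemma convex_on_affineI:
  fixes f :: "real \<Rightarrow> real"
  assumes "\<And>a b u z w. u < z \<Longrightarrow> z < w \<Longrightarrow> f u \<le> a + b * u \<Longrightarrow> f w \<le> a + b * w \<Longrightarrow> f z \<le> a + b * z"
  shows "convex_on UNIV f"
proof (rule convex_on_linorderI)
  fix t x y :: real
  assume t: "0 < t" "t < 1" and xy: "x < y"
  define b where "b = (f y - f x) / (y - x)"
  define a where "a = f x - b * x"
  define z where "z = (1 - t) *\<^sub>R x + t *\<^sub>R y"
  have zx: "z - x = t * (y - x)" and yz: "y - z = (1 - t) * (y - x)"
    by (simp_all add: z_def algebra_simps)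
  have "0 < t * (y - x)" "0 < (1 - t) * (y - x)"
    using t xy by auto
  then have z: "x < z" "z < y"
    by (simp_all flip: zx yz)
  have x: "f x = a + b * x" by (simp add: a_def)
  have "b * (y - x) = f y - f x"
    using xy by (simp add: b_def)
  then have y: "f y = a + b * y" by (simp add: a_def algebra_simps)
  have "f z \<le> a + b * z"
    using assms[OF z] x y by simp
  also have "\<dots> = (1 - t) * f x + t * f y"
    by (simp add: x y z_def algebra_simps)
  finally show "f ((1 - t) *\<^sub>R x + t *\<^sub>R y) \<le> (1 - t) * f x + t * f y"
    by (simp add: z_def)
qed auto

lemma convex_on_max:
  fixes f g :: "real \<Rightarrow> real"
  assumes "convex_on UNIV f" "convex_on UNIV g"
  shows "convex_on UNIV (\<lambda>x. max (f x) (g x))"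
proof (rule convex_on_affineI)
  fix a b u z w :: real
  assume "u < z" "z < w" "max (f u) (g u) \<le> a + b * u" "max (f w) (g w) \<le> a + b * w"
  then show "max (f z) (g z) \<le> a + b * z"
    using convex_on_le_affine[OF assms(1), of u z w a b] convex_on_le_affine[OF assms(2), of u z w a b]
    by simp
qed

lemma convex_on_affine: "convex_on UNIV (\<lambda>x::real. a + b * x)"
  by (rule convex_on_linorderI) (simp_all add: algebra_simps)

lemma convex_on_add_affine:
  assumes "convex_on UNIV f"
  shows "convex_on UNIV (\<lambda>x::real. f x + (a + b * x))"
  using convex_on_add[OF assms convex_on_affine] by simp

lemma convex_slope_mono:
  fixes f :: "real \<Rightarrow> real"
  assumes f: "convex_on UNIV f" and "a < b" "b \<le> c" "c < d"
  shows "(f b - f a) / (b - a) \<le> (f d - f c) / (d - c)"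
proof -
  have 1: "(f y - f x) / (y - x) \<le> (f z - f y) / (z - y)" if "x < y" "y < z" for x y z
    using convex_on_slope_le[OF f UNIV_I UNIV_I that]
    by (smt (verit) minus_diff_eq minus_divide_divide)
  show ?thesis
  proof (cases "b = c")
    case True
    then show ?thesis using 1[of a b d] assms by simp
  next
    case False
    then show ?thesis using 1[of a b c] 1[of b c d] assms by linarith
  qed
qed

text \<open>
  A chord of slope above the growth constant would, by monotonicity of slopes, push $f$ above its linear
  bound far to the right.
\<close>

lemma convex_linear_growth_slope_le:
  fixes f :: "real \<Rightarrow> real"
  assumes f: "convex_on UNIV f" and c: "\<And>x. \<bar>f x\<bar> \<le> c * (1 + \<bar>x\<bar>)" and "x < y"
  shows "f y - f x \<le> c * (y - x)"
proof (rule ccontr)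
  define s where "s = (f y - f x) / (y - x)"
  assume "\<not> ?thesis"
  then have s: "c < s"
    using \<open>x < y\<close> by (simp add: field_simps s_def)
  define z where "z = max (max 0 (y + 1)) ((c + s * y - f y) / (s - c) + 1)"
  have z: "0 \<le> z" "y < z" "(c + s * y - f y) / (s - c) < z"
    by (auto simp: z_def)
  have "s \<le> (f z - f y) / (z - y)"
    using convex_slope_mono[OF f \<open>x < y\<close> order_refl \<open>y < z\<close>] by (simp add: s_def)
  then have "s * (z - y) \<le> f z - f y"
    using z by (subst (asm) pos_le_divide_eq) auto
  moreover have "f z \<le> c * (1 + z)"
    using c[of z] z by auto
  moreover have "c + s * y - f y < z * (s - c)"
    using z(3) s by (subst (asm) pos_divide_less_eq) auto
  ultimately show False by (simp add: algebra_simps)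
qed

lemma convex_reflect: "convex_on UNIV f \<Longrightarrow> convex_on UNIV (\<lambda>x::real. f (- x))"
proof (rule convex_on_affineI)
  fix a b u z w :: real
  assume "convex_on UNIV f" "u < z" "z < w" "f (- u) \<le> a + b * u" "f (- w) \<le> a + b * w"
  then show "f (- z) \<le> a + b * z"
    using convex_on_le_affine[of f "- w" "- z" "- u" a "- b"] by simp
qed

lemma convex_linear_growth_lipschitz:
  fixes f :: "real \<Rightarrow> real"
  assumes f: "convex_on UNIV f" and c: "\<And>x. \<bar>f x\<bar> \<le> c * (1 + \<bar>x\<bar>)"
  shows "\<bar>f x - f y\<bar> \<le> c * \<bar>x - y\<bar>"
proof -
  have le: "\<bar>f x - f y\<bar> \<le> c * (y - x)" if "x < y" for x y
  proof -
    have "f y - f x \<le> c * (y - x)"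
      using convex_linear_growth_slope_le[OF f c that] .
    moreover have "f (- (- x)) - f (- (- y)) \<le> c * (- x - (- y))"
      by (rule convex_linear_growth_slope_le[OF convex_reflect[OF f]]) (use c[of "- _"] that in auto)
    ultimately show ?thesis by (simp add: abs_le_iff)
  qed
  show ?thesis
    using le[of x y] le[of y x] by (cases x y rule: linorder_cases) (auto simp: abs_minus_commute)
qed

text \<open>
  Interpolation of $f$ at the points $a + j h$ for $j \le n + 1$, with the first and the last segment prolonged
  to half-lines. It is written as an affine function plus multiples of hockey sticks, the coefficients being
  increments of successive slopes, so that integrals of it reduce to mass, mean and call functions.
\<close>

primrec polygon :: "(real \<Rightarrow> real) \<Rightarrow> real \<Rightarrow> real \<Rightarrow> nat \<Rightarrow> real \<Rightarrow> real" where
  "polygon f a h 0 x = f a + (f (a + h) - f a) / h * (x - a)"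
| "polygon f a h (Suc n) x = polygon f a h n x +
     ((f (a + (real n + 2) * h) - f (a + (real n + 1) * h)) / h - (f (a + (real n + 1) * h) - f (a + real n * h)) / h)
     * max (x - (a + (real n + 1) * h)) 0"

lemma polygon_last_piece:
  assumes "0 < h" "a + real n * h \<le> x"
  shows "polygon f a h n x =
    f (a + real n * h) + (f (a + (real n + 1) * h) - f (a + real n * h)) / h * (x - (a + real n * h))"
  using assms
proof (induction n)
  case (Suc n)
  define u v where "u = a + real n * h" and "v = a + (real n + 1) * h"
  define s t where "s = (f v - f u) / h" and "t = (f (a + (real n + 2) * h) - f v) / h"
  have sh: "s * h = f v - f u" and uv: "v = u + h" and "v \<le> x"
    using Suc.prems by (simp add: s_def) (use Suc.prems in \<open>simp_all add: u_def v_def algebra_simps\<close>)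
  then have "polygon f a h n x = f u + s * (x - u)"
    using Suc.IH Suc.prems(1) by (simp add: s_def u_def v_def)
  then have "polygon f a h (Suc n) x = f u + s * (x - u) + (t - s) * (x - v)"
    using \<open>v \<le> x\<close> by (simp add: s_def t_def u_def v_def)
  also have "\<dots> = f u + s * h + t * (x - v)"
    by (simp add: uv algebra_simps)
  also have "\<dots> = f v + t * (x - v)"
    using sh by linarith
  finally show ?case
    by (simp add: t_def v_def add.commute)
qed simp

text \<open>
  Every linear piece leaves $f$ at a grid point with a slope of modulus at most $L$, so the error is at most
  $2 L$ times the distance to that grid point.
\<close>

lemma polygon_error:
  assumes h: "0 < h" and L: "\<And>x y. \<bar>f x - f y\<bar> \<le> L * \<bar>x - y\<bar>"
  shows "\<bar>polygon f a h n x - f x\<bar> \<le> 2 * L * (h + max (a - x) 0 + max (x - (a + (real n + 1) * h)) 0)"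
proof -
  have L0: "0 \<le> L" using L[of 0 1] by simp
  have dev: "\<bar>f u + (f (u + h) - f u) / h * (x - u) - f x\<bar> \<le> 2 * L * \<bar>x - u\<bar>" for u x
  proof -
    have "\<bar>(f (u + h) - f u) / h\<bar> \<le> L"
      using L[of "u + h" u] h by (simp add: field_simps)
    then have "\<bar>(f (u + h) - f u) / h * (x - u)\<bar> \<le> L * \<bar>x - u\<bar>"
      by (simp only: abs_mult mult_right_mono abs_ge_zero)
    moreover have "\<bar>f u - f x\<bar> \<le> L * \<bar>x - u\<bar>"
      using L[of u x] by (simp add: abs_minus_commute[of u])
    ultimately show ?thesis by linarith
  qed
  show ?thesis
  proof (induction n)
    case 0
    have "\<bar>x - a\<bar> \<le> h + max (a - x) 0 + max (x - (a + h)) 0"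
      using h by auto
    then have "2 * L * \<bar>x - a\<bar> \<le> 2 * L * (h + max (a - x) 0 + max (x - (a + h)) 0)"
      using L0 by (intro mult_left_mono) auto
    then show ?case using dev[of a x] by simp
  next
    case (Suc n)
    let ?u = "a + real (Suc n) * h"
    show ?case
    proof (cases "?u \<le> x")
      case True
      then have "polygon f a h (Suc n) x = f ?u + (f (?u + h) - f ?u) / h * (x - ?u)"
        using polygon_last_piece[OF h True] by (simp add: algebra_simps)
      moreover have "2 * L * \<bar>x - ?u\<bar> \<le> 2 * L * (h + max (a - x) 0 + max (x - (a + (real (Suc n) + 1) * h)) 0)"
        using L0 h True by (intro mult_left_mono) (auto simp: algebra_simps max_def)
      ultimately show ?thesis using dev[of ?u x] by linarith
    next
      case False
      then have "x - ?u \<le> 0" by simp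
      moreover from this have "x - (a + (real (Suc n) + 1) * h) \<le> 0"
        using h by (simp add: algebra_simps)
      ultimately show ?thesis using Suc.IH False by (simp add: max_def add.commute)
    qed
  qed
qed

text \<open>
  Take for $H$ the largest convex minorant of $f - g$. Suppose that $f - H$ lies below a line $\ell$ at $u$ and
  $w$, and let $J = f - \ell$, which is convex with $J \le H$ at $u$ and $w$. Replacing $H$ by $\max(H, J)$ on
  $[u, w]$ keeps it convex, and keeps it below $f - g$, because $g \le \ell$ on $[u, w]$. Maximality gives
  $J \le H$, that is, $f - H \le \ell$ on $[u, w]$. The function $W$ ensures that convex minorants exist, and is one of them.
\<close>

lemma complement_of_hull_convex:
  fixes f g W :: "real \<Rightarrow> real"
  assumes f: "convex_on UNIV f" and g: "convex_on UNIV g" and W: "convex_on UNIV W"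
    and le: "\<And>x. W x \<le> f x - g x"
  obtains H where "convex_on UNIV H" "\<And>x. W x \<le> H x" "\<And>x. H x \<le> f x - g x"
    "convex_on UNIV (\<lambda>x. f x - H x)"
proof -
  define S where "S = {h. convex_on UNIV h \<and> (\<forall>x. h x \<le> f x - g x)}"
  define H where "H x = (SUP h\<in>S. h x)" for x
  have WS: "W \<in> S" using W le by (simp add: S_def)
  have bdd: "bdd_above ((\<lambda>h. h x) ` S)" for x
    by (rule bdd_aboveI[of _ "f x - g x"]) (auto simp: S_def)
  have upper: "h x \<le> H x" if "h \<in> S" for h x
    unfolding H_def by (rule cSUP_upper[OF that bdd])
  have least: "H x \<le> c" if "\<And>h. h \<in> S \<Longrightarrow> h x \<le> c" for x c
    unfolding H_def using WS that by (intro cSUP_least) auto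
  have convH: "convex_on UNIV H"
  proof (rule convex_on_affineI)
    fix a b u z w
    assume *: "u < z" "z < w" "H u \<le> a + b * u" "H w \<le> a + b * w"
    show "H z \<le> a + b * z"
    proof (rule least)
      fix h assume h: "h \<in> S"
      then show "h z \<le> a + b * z"
        using * upper[OF h, of u] upper[OF h, of w]
        by (intro convex_on_le_affine[of h u z w]) (auto simp: S_def)
    qed
  qed
  have HD: "H x \<le> f x - g x" for x
    by (rule least) (simp add: S_def)
  have "convex_on UNIV (\<lambda>x. f x - H x)"
  proof (rule convex_on_affineI)
    fix a b u z w
    assume uz: "u < z" and zw: "z < w" and fu: "f u - H u \<le> a + b * u" and fw: "f w - H w \<le> a + b * w"
    define J where "J x = f x + ((- a) + (- b) * x)" for x
    have J: "convex_on UNIV J"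
      unfolding J_def by (rule convex_on_add_affine[OF f])
    have Ju: "J u \<le> H u" and Jw: "J w \<le> H w"
      using fu fw by (auto simp: J_def)
    define K where "K x = (if u \<le> x \<and> x \<le> w then max (H x) (J x) else H x)" for x
    have HK: "H x \<le> K x" for x by (simp add: K_def)
    have "convex_on UNIV K"
    proof (rule convex_on_affineI)
      fix a' b' u' z' w'
      assume *: "u' < z'" "z' < w'" "K u' \<le> a' + b' * u'" "K w' \<le> a' + b' * w'"
      have H: "H x \<le> a' + b' * x" if "u' \<le> x" "x \<le> w'" for x
        using convex_on_le_affine[OF convH that, of a' b'] * HK[of u'] HK[of w'] by linarith
      show "K z' \<le> a' + b' * z'"
      proof (cases "u \<le> z' \<and> z' \<le> w")
        case True
        have "J (max u u') \<le> a' + b' * max u u'"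
        proof (cases "u \<le> u'")
          case True
          then show ?thesis using * \<open>u \<le> z' \<and> z' \<le> w\<close> by (auto simp: max_def K_def split: if_splits)
        next
          case False
          then show ?thesis using Ju H[of u] * True by (auto simp: max_def)
        qed
        moreover have "J (min w w') \<le> a' + b' * min w w'"
        proof (cases "w' \<le> w")
          case True
          then show ?thesis using * \<open>u \<le> z' \<and> z' \<le> w\<close> by (auto simp: min_def K_def max_def split: if_splits)
        next
          case False
          then show ?thesis using Jw H[of w] * True by (auto simp: min_def)
        qed
        ultimately have "J z' \<le> a' + b' * z'"
          using * True by (intro convex_on_le_affine[OF J, of "max u u'" z' "min w w'"]) auto
        then show ?thesis using H[of z'] * by (simp add: K_def)
      next
        case False
        then show ?thesis using H[of z'] * by (auto simp: K_def)
      qed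
    qed
    moreover have "K x \<le> f x - g x" for x
    proof -
      have "J x \<le> f x - g x" if x: "u \<le> x" "x \<le> w"
      proof -
        have "g x \<le> a + b * x"
          using HD[of u] HD[of w] fu fw by (intro convex_on_le_affine[OF g x]) linarith+
        then show ?thesis by (simp add: J_def)
      qed
      then show ?thesis using HD[of x] by (simp add: K_def)
    qed
    ultimately have "K \<in> S" by (simp add: S_def)
    then have "J z \<le> H z"
      using upper[of K z] uz zw by (simp add: K_def)
    then show "f z - H z \<le> a + b * z" by (simp add: J_def)
  qed
  with that convH HD upper[OF WS] show thesis by blast
qed

text \<open>
  The complement is the function $x \mapsto \sup_{y \le x} (f(x) - f(y) + g(y))$. A line above it at $u < w$
  is above $f + e$ at $w$ for every constant $e = g(y) - f(y)$ with $y \le w$. If $y \le u$, the same holds at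
  $u$, and convexity of $f$ suffices between. If $u < y \le z$, convexity of $g$ puts $g(y) = f(y) + e$ below the
  line, and convexity of $f$ on $[y, w]$ does the rest.
\<close>

lemma complement_of_running_infimum_convex:
  fixes f g :: "real \<Rightarrow> real"
  assumes f: "convex_on UNIV f" and g: "convex_on UNIV g" and le: "\<And>x. g x \<le> f x"
  shows "convex_on UNIV (\<lambda>x. f x - (INF y\<in>{..x}. f y - g y))" (is "convex_on UNIV (\<lambda>x. f x - ?H x)")
proof -
  have bdd: "bdd_below ((\<lambda>y. f y - g y) ` A)" for A
    by (rule bdd_belowI[of _ 0]) (use le in auto)
  have H: "?H x \<le> f y - g y" if "y \<le> x" for x y
    by (rule cINF_lower[OF bdd]) (use that in simp)
  have Hge: "c \<le> ?H x" if "\<And>y. y \<le> x \<Longrightarrow> c \<le> f y - g y" for c x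
    using that by (intro cINF_greatest) auto
  show ?thesis
  proof (rule convex_on_affineI)
    fix a b u z w
    assume *: "u < z" "z < w" "f u - ?H u \<le> a + b * u" "f w - ?H w \<le> a + b * w"
    have "f z - (a + b * z) \<le> ?H z"
    proof (rule Hge)
      fix y assume y: "y \<le> z"
      define e where "e = f y - g y"
      have w: "f w \<le> (e + a) + b * w"
        using H[of y w] y * by (simp add: e_def)
      have "f z \<le> (e + a) + b * z"
      proof (cases "y \<le> u")
        case True
        then have "f u \<le> (e + a) + b * u"
          using H[of y u] * by (simp add: e_def)
        then show ?thesis
          using w * by (intro convex_on_le_affine[OF f, of u z w]) auto
      next
        case False
        have "g u \<le> a + b * u" "g w \<le> a + b * w"
          using H[of u u] H[of w w] * by auto
        then have "g y \<le> a + b * y"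
          using False y * by (intro convex_on_le_affine[OF g, of u y w]) auto
        then have "f y \<le> (e + a) + b * y" by (simp add: e_def)
        then show ?thesis
          using w y * by (intro convex_on_le_affine[OF f, of y z w]) auto
      qed
      then show "f z - (a + b * z) \<le> f y - g y" by (simp add: e_def)
    qed
    then show "f z - ?H z \<le> a + b * z" by simp
  qed
qed

section \<open>Measures with finite first moment and their call functions\<close>

abbreviation mass :: "real measure \<Rightarrow> real" where
  "mass \<mu> \<equiv> measure \<mu> UNIV"

abbreviation mean :: "real measure \<Rightarrow> real" where
  "mean \<mu> \<equiv> \<integral>y. y \<partial>\<mu>"

abbreviation tail :: "real measure \<Rightarrow> real \<Rightarrow> real" where
  "tail \<mu> k \<equiv> measure \<mu> {k<..}"

definition call :: "real measure \<Rightarrow> real \<Rightarrow> real" where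
  "call \<mu> k = (\<integral>y. max (y - k) 0 \<partial>\<mu>)"

text \<open>
  For $u \le v$ this is the integral of $\mu(t, \infty)$ over $t \in [u, v]$, which is the difference of the
  values of the call function at $u$ and $v$ if there is a finite first moment. The integrand is bounded, so
  the definition makes sense for every finite measure.
\<close>

definition clamped :: "real measure \<Rightarrow> real \<Rightarrow> real \<Rightarrow> real" where
  "clamped \<mu> u v = (\<integral>y. min (max y u) v - u \<partial>\<mu>)"

lemma first_momentD:
  assumes "\<mu> \<in> \<M>"
  shows "sets \<mu> = sets borel" "finite_measure \<mu>" "integrable \<mu> (\<lambda>x. \<bar>x\<bar>)" "space \<mu> = UNIV"
  using assms sets_eq_imp_space_eq[of \<mu> borel] by (auto simp: finite_first_moment_measures_def)

lemma first_momentI: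
  assumes "sets \<mu> = sets borel" "finite_measure \<mu>" "integrable \<mu> (\<lambda>x. \<bar>x\<bar>)"
  shows "\<mu> \<in> \<M>"
  unfolding finite_first_moment_measures_def using assms by blast

lemma linear_growthI:
  assumes "\<phi> \<in> borel_measurable borel" "\<And>x. \<bar>\<phi> x\<bar> \<le> c * (1 + \<bar>x\<bar>)"
  shows "\<phi> \<in> linear_growth_functions"
  using assms by (auto simp: linear_growth_functions_def)

lemma integrable_linear_growth:
  assumes \<mu>: "\<mu> \<in> \<M>" and \<phi>: "\<phi> \<in> linear_growth_functions"
  shows "integrable \<mu> \<phi>"
proof -
  interpret finite_measure \<mu> by (rule first_momentD(2)[OF \<mu>])
  obtain c where c: "\<And>x. \<bar>\<phi> x\<bar> \<le> c * (1 + \<bar>x\<bar>)" and m: "\<phi> \<in> borel_measurable borel"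
    using \<phi> by (auto simp: linear_growth_functions_def)
  show ?thesis
  proof (rule Bochner_Integration.integrable_bound)
    show "integrable \<mu> (\<lambda>x. c * (1 + \<bar>x\<bar>))"
      using first_momentD(3)[OF \<mu>] by auto
    show "\<phi> \<in> borel_measurable \<mu>"
      using m first_momentD(1)[OF \<mu>] by (simp cong: measurable_cong_sets)
    show "AE x in \<mu>. norm (\<phi> x) \<le> norm (c * (1 + \<bar>x\<bar>))"
    proof (rule AE_I2)
      fix x show "norm (\<phi> x) \<le> norm (c * (1 + \<bar>x\<bar>))"
        using c[of x] by (metis abs_ge_self order_trans real_norm_def)
    qed
  qed
qed

lemma linear_growth_Lipschitz:
  assumes "\<And>x y. \<bar>\<phi> x - \<phi> y\<bar> \<le> L * \<bar>x - y\<bar>"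
  shows "\<phi> \<in> linear_growth_functions"
proof (rule linear_growthI)
  have L: "0 \<le> L" using assms[of 0 1] by simp
  then have "L-lipschitz_on UNIV \<phi>"
    using assms by (auto intro!: lipschitz_onI simp: dist_real_def)
  then show "\<phi> \<in> borel_measurable borel"
    by (intro borel_measurable_continuous_onI lipschitz_on_continuous_on)
  fix x
  have "\<bar>\<phi> x\<bar> \<le> \<bar>\<phi> 0\<bar> + L * \<bar>x\<bar>" using assms[of x 0] by simp
  also have "\<dots> \<le> (\<bar>\<phi> 0\<bar> + L) * (1 + \<bar>x\<bar>)"
    using L by (simp add: algebra_simps)
  finally show "\<bar>\<phi> x\<bar> \<le> (\<bar>\<phi> 0\<bar> + L) * (1 + \<bar>x\<bar>)" .
qed

lemma linear_growth_simps [simp]: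
  "(\<lambda>y. max (y - k) 0) \<in> linear_growth_functions"
  "(\<lambda>y. max (k - y) 0) \<in> linear_growth_functions"
  "(\<lambda>y. max y k) \<in> linear_growth_functions"
  "(\<lambda>y. y) \<in> linear_growth_functions"
  "(\<lambda>y. k) \<in> linear_growth_functions"
  by (rule linear_growth_Lipschitz[where L = 1], simp add: max_def abs_minus_commute)+

lemma integrable_call [simp]:
  assumes "\<mu> \<in> \<M>"
  shows "integrable \<mu> (\<lambda>y. max (y - k) 0)" "integrable \<mu> (\<lambda>y. max (k - y) 0)"
    "integrable \<mu> (\<lambda>y. max y k)" "integrable \<mu> (\<lambda>y. y)" "integrable \<mu> (\<lambda>y. k)"
  by (auto intro!: integrable_linear_growth assms)

text \<open>
  Put-call parity: $(k - y)^+ = (y - k)^+ + k - y$.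
\<close>

lemma put_eq:
  assumes "\<mu> \<in> \<M>"
  shows "(\<integral>y. max (k - y) 0 \<partial>\<mu>) = call \<mu> k + mass \<mu> * k - mean \<mu>"
proof -
  have "(\<integral>y. max (k - y) 0 \<partial>\<mu>) = (\<integral>y. max (y - k) 0 + k - y \<partial>\<mu>)"
    by (rule Bochner_Integration.integral_cong) auto
  also have "\<dots> = call \<mu> k + mass \<mu> * k - mean \<mu>"
    using assms by (simp add: call_def first_momentD(4))
  finally show ?thesis .
qed

lemma call_plus_line_eq:
  assumes "\<mu> \<in> \<M>"
  shows "call \<mu> k + mass \<mu> * k = (\<integral>y. max y k \<partial>\<mu>)"
proof -
  have "(\<integral>y. max y k \<partial>\<mu>) = (\<integral>y. max (y - k) 0 + k \<partial>\<mu>)"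
    by (rule Bochner_Integration.integral_cong) auto
  also have "\<dots> = call \<mu> k + mass \<mu> * k"
    using assms by (simp add: call_def first_momentD(4))
  finally show ?thesis by simp
qed

lemma call_ge_line:
  assumes "\<mu> \<in> \<M>"
  shows "mean \<mu> - mass \<mu> * k \<le> call \<mu> k"
proof -
  have "0 \<le> (\<integral>y. max (k - y) 0 \<partial>\<mu>)"
    by (rule Bochner_Integration.integral_nonneg) auto
  then show ?thesis by (simp add: put_eq[OF assms])
qed

lemma mono_call_plus_line:
  assumes \<mu>: "\<mu> \<in> \<M>" and "k \<le> l"
  shows "call \<mu> k + mass \<mu> * k \<le> call \<mu> l + mass \<mu> * l"
  unfolding call_plus_line_eq[OF \<mu>] using assms by (intro integral_mono) auto

lemma convex_call:
  assumes "\<mu> \<in> \<M>"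
  shows "convex_on UNIV (call \<mu>)"
proof (rule convex_on_linorderI)
  fix t x y :: real
  assume t: "0 < t" "t < 1"
  have "call \<mu> ((1 - t) *\<^sub>R x + t *\<^sub>R y) \<le> (\<integral>z. (1 - t) * max (z - x) 0 + t * max (z - y) 0 \<partial>\<mu>)"
    unfolding call_def
  proof (rule integral_mono)
    fix z
    have "z - ((1 - t) *\<^sub>R x + t *\<^sub>R y) = (1 - t) * (z - x) + t * (z - y)"
      by (simp add: algebra_simps)
    also have "\<dots> \<le> (1 - t) * max (z - x) 0 + t * max (z - y) 0"
      using t by (intro add_mono mult_left_mono) auto
    finally show "max (z - ((1 - t) *\<^sub>R x + t *\<^sub>R y)) 0 \<le> (1 - t) * max (z - x) 0 + t * max (z - y) 0"
      using t by auto
  qed (use assms in auto)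
  also have "\<dots> = (1 - t) * call \<mu> x + t * call \<mu> y"
    using assms by (simp add: call_def)
  finally show "call \<mu> ((1 - t) *\<^sub>R x + t *\<^sub>R y) \<le> (1 - t) * call \<mu> x + t * call \<mu> y" .
qed auto

lemma call_at_top:
  assumes \<mu>: "\<mu> \<in> \<M>"
  shows "(call \<mu> \<longlongrightarrow> 0) at_top"
proof -
  have "((\<lambda>k. \<integral>y. max (y - k) 0 \<partial>\<mu>) \<longlongrightarrow> (\<integral>y. 0 \<partial>\<mu>)) at_top"
  proof (rule integral_dominated_convergence_at_top[where w = "\<lambda>y. \<bar>y\<bar>"])
    show "integrable \<mu> (\<lambda>y. \<bar>y\<bar>)" by (rule first_momentD(3)[OF \<mu>])
    show "\<forall>\<^sub>F k in at_top. AE y in \<mu>. norm (max (y - k) 0) \<le> \<bar>y\<bar>"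
      using eventually_ge_at_top[of 0] by eventually_elim auto
    show "AE y in \<mu>. ((\<lambda>k. max (y - k) 0) \<longlongrightarrow> 0) at_top"
    proof (rule AE_I2)
      fix y :: real
      show "((\<lambda>k. max (y - k) 0) \<longlongrightarrow> 0) at_top"
        by (intro tendsto_eventually eventually_mono[OF eventually_ge_at_top[of "y"]]) auto
    qed
  qed (use integrable_call(1)[OF \<mu>] in auto)
  then show ?thesis by (simp add: call_def[abs_def])
qed

lemma call_at_bot:
  assumes \<mu>: "\<mu> \<in> \<M>"
  shows "((\<lambda>k. call \<mu> k + mass \<mu> * k) \<longlongrightarrow> mean \<mu>) at_bot"
proof -
  have "((\<lambda>k. \<integral>y. max y (- k) \<partial>\<mu>) \<longlongrightarrow> (\<integral>y. y \<partial>\<mu>)) at_top"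
  proof (rule integral_dominated_convergence_at_top[where w = "\<lambda>y. \<bar>y\<bar>"])
    show "integrable \<mu> (\<lambda>y. \<bar>y\<bar>)" by (rule first_momentD(3)[OF \<mu>])
    show "\<forall>\<^sub>F k in at_top. AE y in \<mu>. norm (max y (- k)) \<le> \<bar>y\<bar>"
      using eventually_ge_at_top[of 0] by eventually_elim auto
    show "AE y in \<mu>. ((\<lambda>k. max y (- k)) \<longlongrightarrow> y) at_top"
    proof (rule AE_I2)
      fix y :: real
      show "((\<lambda>k. max y (- k)) \<longlongrightarrow> y) at_top"
        by (intro tendsto_eventually eventually_mono[OF eventually_ge_at_top[of "- y"]]) auto
    qed
  qed (use integrable_call(3,4)[OF \<mu>] in auto)
  then show ?thesis
    unfolding call_plus_line_eq[OF \<mu>] filterlim_at_bot_mirror .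
qed

lemma clamped_bounds:
  assumes "finite_measure \<mu>" "sets \<mu> = sets borel" "u \<le> v"
  shows "(v - u) * tail \<mu> v \<le> clamped \<mu> u v" "clamped \<mu> u v \<le> (v - u) * tail \<mu> u"
    and integrable_clamped: "integrable \<mu> (\<lambda>y. min (max y u) v - u)"
proof -
  interpret finite_measure \<mu> by fact
  have [measurable_cong]: "sets \<mu> = sets borel" by fact
  show int: "integrable \<mu> (\<lambda>y. min (max y u) v - u)"
    using \<open>u \<le> v\<close> by (intro integrable_const_bound[where B = "v - u"]) auto
  have ind: "integrable \<mu> (\<lambda>y. (v - u) * indicator {a<..} y)" for a
    by (intro integrable_mult_right integrable_real_indicator) (auto simp: assms(2) less_top[symmetric])
  have "(\<integral>y. (v - u) * indicator {v<..} y \<partial>\<mu>) \<le> clamped \<mu> u v"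
    unfolding clamped_def using \<open>u \<le> v\<close>
    by (intro integral_mono int ind) (auto split: split_indicator)
  then show "(v - u) * tail \<mu> v \<le> clamped \<mu> u v" by (simp add: assms(2))
  have "clamped \<mu> u v \<le> (\<integral>y. (v - u) * indicator {u<..} y \<partial>\<mu>)"
    unfolding clamped_def using \<open>u \<le> v\<close>
    by (intro integral_mono int ind) (auto split: split_indicator)
  then show "clamped \<mu> u v \<le> (v - u) * tail \<mu> u" by (simp add: assms(2))
qed

lemma call_diff_eq_clamped:
  assumes "\<mu> \<in> \<M>" "u \<le> v"
  shows "call \<mu> u - call \<mu> v = clamped \<mu> u v"
proof -
  have "clamped \<mu> u v = (\<integral>y. max (y - u) 0 - max (y - v) 0 \<partial>\<mu>)"
    unfolding clamped_def using \<open>u \<le> v\<close> by (intro Bochner_Integration.integral_cong) auto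
  then show ?thesis using assms by (simp add: call_def)
qed

lemma tail_right_continuous:
  assumes "finite_measure \<mu>" "sets \<mu> = sets borel"
  shows "(\<lambda>n. tail \<mu> (x + 1 / real (Suc n))) \<longlonglongrightarrow> tail \<mu> x"
proof -
  interpret finite_measure \<mu> by fact
  have "(\<lambda>n. measure \<mu> {x + 1 / real (Suc n)<..}) \<longlonglongrightarrow> measure \<mu> (\<Union>n. {x + 1 / real (Suc n)<..})"
  proof (rule finite_Lim_measure_incseq)
    show "incseq (\<lambda>n. {x + 1 / real (Suc n)<..})"
    proof (rule incseq_SucI)
      fix n
      have "1 / real (Suc (Suc n)) \<le> 1 / real (Suc n)"
        by (intro divide_left_mono) auto
      then show "{x + 1 / real (Suc n)<..} \<le> {x + 1 / real (Suc (Suc n))<..}"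
        by auto
    qed
  qed (auto simp: assms)
  also have "(\<Union>n. {x + 1 / real (Suc n)<..}) = {x<..}"
  proof safe
    fix y n assume "x + 1 / real (Suc n) < y"
    moreover have "0 < 1 / real (Suc n)" by simp
    ultimately show "x < y" by linarith
  next
    fix y assume "x < y"
    then obtain n where "1 / real (Suc n) < y - x"
      using nat_approx_posE[of "y - x"] by auto
    then show "y \<in> (\<Union>n. {x + 1 / real (Suc n)<..})" by (auto intro!: exI[of _ n])
  qed
  finally show ?thesis .
qed

text \<open>
  The tail is minus the right derivative of the call function. Comparing difference quotients over
  $[x, x + 1/n]$ and letting $n \to \infty$ avoids speaking of derivatives.
\<close>

lemma tail_le_of_call_diff_antimono:
  assumes \<mu>: "\<mu> \<in> \<M>" and \<nu>: "\<nu> \<in> \<M>" and anti: "antimono (\<lambda>k. call \<nu> k - call \<mu> k)"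
  shows "tail \<mu> x \<le> tail \<nu> x"
proof -
  have "tail \<mu> (x + 1 / real (Suc n)) \<le> tail \<nu> x" for n
  proof -
    define v where "v = x + 1 / real (Suc n)"
    have v: "x < v" by (simp add: v_def)
    have "(v - x) * tail \<mu> v \<le> call \<mu> x - call \<mu> v"
      using clamped_bounds(1)[of \<mu> x v] first_momentD[OF \<mu>] call_diff_eq_clamped[OF \<mu>, of x v] v by simp
    also have "\<dots> \<le> call \<nu> x - call \<nu> v"
      using antimonoD[OF anti, of x v] v by simp
    also have "\<dots> \<le> (v - x) * tail \<nu> x"
      using clamped_bounds(2)[of \<nu> x v] first_momentD[OF \<nu>] call_diff_eq_clamped[OF \<nu>, of x v] v by simp
    finally have "tail \<mu> v \<le> tail \<nu> x" using v by simp
    then show ?thesis by (simp add: v_def)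
  qed
  then show ?thesis
    by (intro LIMSEQ_le_const2[OF tail_right_continuous[OF first_momentD(2,1)[OF \<mu>], of x]]) blast
qed

lemma measure_eq_of_tail_eq:
  assumes "finite_measure \<mu>" "sets \<mu> = sets borel" "finite_measure \<nu>" "sets \<nu> = sets borel"
    and "\<And>x. tail \<mu> x = tail \<nu> x"
  shows "\<mu> = \<nu>"
  by (rule measure_eqI_lessThan)
    (use assms in \<open>auto simp: finite_measure.emeasure_eq_measure less_top[symmetric]\<close>)

lemma measure_eq_of_call_eq:
  assumes \<mu>: "\<mu> \<in> \<M>" and \<nu>: "\<nu> \<in> \<M>" and eq: "\<And>k. call \<mu> k = call \<nu> k"
  shows "\<mu> = \<nu>"
proof (rule measure_eq_of_tail_eq)
  fix x show "tail \<mu> x = tail \<nu> x"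
    using tail_le_of_call_diff_antimono[OF \<mu> \<nu>] tail_le_of_call_diff_antimono[OF \<nu> \<mu>] eq
    by (intro antisym) (auto simp: antimono_def)
qed (use first_momentD[OF \<mu>] first_momentD[OF \<nu>] in auto)

section \<open>Sums of two measures\<close>

definition add_measure :: "'a measure \<Rightarrow> 'a measure \<Rightarrow> 'a measure" where
  "add_measure M N = measure_of (space M) (sets M) (\<lambda>A. emeasure M A + emeasure N A)"

lemma sets_add_measure [simp, measurable_cong]: "sets (add_measure M N) = sets M"
  by (simp add: add_measure_def)

lemma space_add_measure [simp]: "space (add_measure M N) = space M"
  by (simp add: add_measure_def)

lemma emeasure_add_measure:
  assumes "sets N = sets M" "A \<in> sets M"
  shows "emeasure (add_measure M N) A = emeasure M A + emeasure N A"
proof (rule emeasure_measure_of[OF add_measure_def])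
  show "countably_additive (sets (add_measure M N)) (\<lambda>A. emeasure M A + emeasure N A)"
  proof (rule countably_additiveI)
    fix A :: "nat \<Rightarrow> _"
    assume A: "range A \<subseteq> sets (add_measure M N)" "disjoint_family A"
    then have "(\<Sum>i. emeasure M (A i) + emeasure N (A i)) = (\<Sum>i. emeasure M (A i)) + (\<Sum>i. emeasure N (A i))"
      by (intro suminf_add[symmetric]) auto
    also have "\<dots> = emeasure M (\<Union>i. A i) + emeasure N (\<Union>i. A i)"
      using A assms by (simp add: suminf_emeasure)
    finally show "(\<Sum>i. emeasure M (A i) + emeasure N (A i)) = emeasure M (\<Union>i. A i) + emeasure N (\<Union>i. A i)" .
  qed
qed (use assms in \<open>auto simp: positive_def sets.space_closed dest: sets.sets_into_space\<close>)

lemma nn_integral_add_measure: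
  assumes sets: "sets N = sets M" and f: "f \<in> borel_measurable M"
  shows "(\<integral>\<^sup>+x. f x \<partial>add_measure M N) = (\<integral>\<^sup>+x. f x \<partial>M) + (\<integral>\<^sup>+x. f x \<partial>N)"
  using f
proof (induction f rule: borel_measurable_induct)
  case (cong f g)
  moreover have "integral\<^sup>N K f = integral\<^sup>N K g" if "space K = space M" for K
    using cong that by (intro nn_integral_cong) auto
  ultimately show ?case by (simp add: sets_eq_imp_space_eq[OF sets])
next
  case (set A)
  then show ?case by (simp add: emeasure_add_measure sets)
next
  case (mult u c)
  then show ?case
    by (simp add: nn_integral_cmult distrib_left sets cong: measurable_cong_sets)
next
  case (add u v)
  then show ?case
    by (simp add: nn_integral_add ac_simps sets cong: measurable_cong_sets)
next
  case (seq U)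
  then have U: "U i \<in> borel_measurable N" for i by (simp add: sets cong: measurable_cong_sets)
  have "(\<integral>\<^sup>+x. (SUP i. U i) x \<partial>K) = (SUP i. \<integral>\<^sup>+x. U i x \<partial>K)" if "\<And>i. U i \<in> borel_measurable K" for K
    using seq that by (simp add: nn_integral_monotone_convergence_SUP image_comp)
  moreover have "(SUP i. integral\<^sup>N M (U i)) + (SUP i. integral\<^sup>N N (U i)) = (SUP i. integral\<^sup>N M (U i) + integral\<^sup>N N (U i))"
    using seq by (intro ennreal_SUP_add[symmetric])
      (auto simp: incseq_def le_fun_def intro!: nn_integral_mono)
  ultimately show ?case using seq U by simp
qed

lemma integral_add_measure:
  fixes f :: "'a \<Rightarrow> real"
  assumes sets: "sets N = sets M" and M: "integrable M f" and N: "integrable N f"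
  shows "integrable (add_measure M N) f"
    and "(\<integral>x. f x \<partial>add_measure M N) = (\<integral>x. f x \<partial>M) + (\<integral>x. f x \<partial>N)"
proof -
  have m: "f \<in> borel_measurable M" using M by auto
  note nn = nn_integral_add_measure[OF sets, of "\<lambda>x. ennreal (f x)"]
    nn_integral_add_measure[OF sets, of "\<lambda>x. ennreal (- f x)"]
  show int: "integrable (add_measure M N) f"
    using M N m nn by (auto simp: real_integrable_def ennreal_add_eq_top)
  show "(\<integral>x. f x \<partial>add_measure M N) = (\<integral>x. f x \<partial>M) + (\<integral>x. f x \<partial>N)"
    using M N m nn int
    by (simp add: real_lebesgue_integral_def enn2real_plus real_integrable_def less_top)
qed

lemma add_measure_finite:
  assumes "finite_measure \<mu>" "sets \<mu> = sets borel" "finite_measure \<nu>" "sets \<nu> = sets borel"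
  shows "finite_measure (add_measure \<mu> \<nu>)"
    and "A \<in> sets borel \<Longrightarrow> measure (add_measure \<mu> \<nu>) A = measure \<mu> A + measure \<nu> A"
proof -
  interpret m: finite_measure \<mu> by fact
  interpret n: finite_measure \<nu> by fact
  have [simp]: "space \<mu> = UNIV" "space \<nu> = UNIV" 
    using assms(2,4)[THEN sets_eq_imp_space_eq] by simp_all
  show "finite_measure (add_measure \<mu> \<nu>)"
    by (rule finite_measureI)
      (use assms in \<open>simp add: emeasure_add_measure m.emeasure_eq_measure n.emeasure_eq_measure\<close>)
  show "A \<in> sets borel \<Longrightarrow> measure (add_measure \<mu> \<nu>) A = measure \<mu> A + measure \<nu> A"
    using assms by (simp add: measure_def emeasure_add_measure enn2real_plus less_top[symmetric])
qed

lemma add_measure_first_moment: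
  assumes \<mu>: "\<mu> \<in> \<M>" and \<nu>: "\<nu> \<in> \<M>"
  shows "add_measure \<mu> \<nu> \<in> \<M>"
    and "mass (add_measure \<mu> \<nu>) = mass \<mu> + mass \<nu>"
    and "\<phi> \<in> linear_growth_functions \<Longrightarrow>
      (\<integral>x. \<phi> x \<partial>add_measure \<mu> \<nu>) = (\<integral>x. \<phi> x \<partial>\<mu>) + (\<integral>x. \<phi> x \<partial>\<nu>)"
    and "tail (add_measure \<mu> \<nu>) k = tail \<mu> k + tail \<nu> k"
    and "call (add_measure \<mu> \<nu>) k = call \<mu> k + call \<nu> k"
    and "mean (add_measure \<mu> \<nu>) = mean \<mu> + mean \<nu>"
proof -
  note m = first_momentD[OF \<mu>] and n = first_momentD[OF \<nu>]
  have fin: "finite_measure (add_measure \<mu> \<nu>)"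
    by (rule add_measure_finite(1)[OF m(2,1) n(2,1)])
  have eq: "sets \<nu> = sets \<mu>" using m(1) n(1) by (rule trans[OF _ sym, rotated])
  show "add_measure \<mu> \<nu> \<in> \<M>"
    using integral_add_measure(1)[OF eq m(3) n(3)] fin m(1) by (intro first_momentI) (simp only: sets_add_measure)+
  show *: "(\<integral>x. \<phi> x \<partial>add_measure \<mu> \<nu>) = (\<integral>x. \<phi> x \<partial>\<mu>) + (\<integral>x. \<phi> x \<partial>\<nu>)"
    if "\<phi> \<in> linear_growth_functions" for \<phi>
    by (intro integral_add_measure integrable_linear_growth \<mu> \<nu> that eq)
  show "mass (add_measure \<mu> \<nu>) = mass \<mu> + mass \<nu>" "tail (add_measure \<mu> \<nu>) k = tail \<mu> k + tail \<nu> k"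
    using add_measure_finite(2)[OF m(2,1) n(2,1)] by simp_all
  show "call (add_measure \<mu> \<nu>) k = call \<mu> k + call \<nu> k" "mean (add_measure \<mu> \<nu>) = mean \<mu> + mean \<nu>"
    unfolding call_def by (rule *, simp)+
qed

section \<open>Consequences of the relations and criteria for them\<close>

lemma preceqD:
  assumes "preceq R \<mu> \<nu>" "\<phi> \<in> linear_growth_functions"
    and "Nonneg \<in> R \<Longrightarrow> \<forall>x. 0 \<le> \<phi> x" "Sto \<in> R \<Longrightarrow> mono \<phi>" "Cvx \<in> R \<Longrightarrow> convex_on UNIV \<phi>"
  shows "(\<integral>x. \<phi> x \<partial>\<mu>) \<le> (\<integral>x. \<phi> x \<partial>\<nu>)"
proof -
  have "\<phi> \<in> test_functions r" if "r \<in> R" for r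
    using assms that by (cases r) auto
  then show ?thesis using assms(1) by (auto simp: preceq_def)
qed

lemma convex_on_hockey_stick: "convex_on UNIV (\<lambda>y::real. max (y - k) 0)" "convex_on UNIV (\<lambda>y::real. max (k - y) 0)"
  using convex_on_max[OF convex_on_affine[of "- k" 1] convex_on_affine[of 0 0]]
    convex_on_max[OF convex_on_affine[of k "- 1"] convex_on_affine[of 0 0]] by simp_all

lemma preceq_call_le:
  assumes "preceq R \<mu> \<nu>"
  shows "call \<mu> k \<le> call \<nu> k"
  unfolding call_def by (rule preceqD[OF assms]) (auto intro: convex_on_hockey_stick simp: mono_def)

text \<open>
  Which quantities are comparable depends on the subscripts: the constant $1$ is always a test function, $-1$ is
  one unless $+$ occurs, $(k - y)^+$ unless sto occurs, and the indicator of $(k, \infty)$ unless $C$ occurs.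
\<close>

lemma preceq_mass_le:
  assumes \<mu>: "\<mu> \<in> \<M>" and \<nu>: "\<nu> \<in> \<M>" and "preceq R \<mu> \<nu>"
  shows "mass \<mu> \<le> mass \<nu>"
  using preceqD[OF assms(3), of "\<lambda>_. 1"] convex_on_affine[of 1 0]
  by (simp add: first_momentD(4)[OF \<mu>] first_momentD(4)[OF \<nu>] mono_def)

lemma preceq_mass_eq:
  assumes \<mu>: "\<mu> \<in> \<M>" and \<nu>: "\<nu> \<in> \<M>" and "preceq R \<mu> \<nu>" "Nonneg \<notin> R"
  shows "mass \<mu> = mass \<nu>"
  using preceqD[OF assms(3), of "\<lambda>_. - 1"] convex_on_affine[of "- 1" 0] assms(4)
    preceq_mass_le[OF assms(1-3)]
  by (simp add: first_momentD(4)[OF \<mu>] first_momentD(4)[OF \<nu>] mono_def)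

lemma preceq_put_le:
  assumes \<mu>: "\<mu> \<in> \<M>" and \<nu>: "\<nu> \<in> \<M>" and "preceq R \<mu> \<nu>" "Sto \<notin> R"
  shows "call \<mu> k + mass \<mu> * k - mean \<mu> \<le> call \<nu> k + mass \<nu> * k - mean \<nu>"
  unfolding put_eq[OF \<mu>, symmetric] put_eq[OF \<nu>, symmetric]
  using assms(4) by (intro preceqD[OF assms(3)]) (auto intro: convex_on_hockey_stick)

lemma preceq_tail_le:
  assumes \<mu>: "\<mu> \<in> \<M>" and \<nu>: "\<nu> \<in> \<M>" and "preceq R \<mu> \<nu>" "Cvx \<notin> R"
  shows "tail \<mu> k \<le> tail \<nu> k"
proof -
  have "(\<integral>x. indicator {k<..} x \<partial>\<mu>) \<le> (\<integral>x. indicator {k<..} x \<partial>\<nu> :: real)"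
  proof (rule preceqD[OF assms(3)])
    show "indicator {k<..} \<in> linear_growth_functions"
      by (rule linear_growthI[where c = 1]) (auto split: split_indicator)
  qed (use assms(4) in \<open>auto simp: mono_def split: split_indicator\<close>)
  then show ?thesis using first_momentD[OF \<mu>] first_momentD[OF \<nu>] by simp
qed

lemma preceq_Nonneg_add_measure:
  assumes "\<mu> \<in> \<M>" "\<eta> \<in> \<M>"
  shows "preceq {Nonneg} \<mu> (add_measure \<mu> \<eta>)"
  using assms by (auto simp: preceq_def add_measure_first_moment(3) intro!: Bochner_Integration.integral_nonneg)

lemma nn_integral_layer_cake:
  fixes f :: "'a \<Rightarrow> real"
  assumes "sigma_finite_measure M" and [measurable]: "f \<in> borel_measurable M"
  shows "(\<integral>\<^sup>+x. ennreal (f x) \<partial>M) =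
    (\<integral>\<^sup>+t. indicator {0..} t * emeasure M {x \<in> space M. t < f x} \<partial>lborel)"
proof -
  interpret M: sigma_finite_measure M by fact
  interpret pair_sigma_finite M lborel ..
  have "(\<integral>\<^sup>+x. ennreal (f x) \<partial>M) = (\<integral>\<^sup>+x. (\<integral>\<^sup>+t. (if 0 \<le> t \<and> t < f x then 1 else 0) \<partial>lborel) \<partial>M)"
  proof (rule nn_integral_cong)
    fix x
    have "(\<integral>\<^sup>+t. (if 0 \<le> t \<and> t < f x then 1 else 0) \<partial>lborel) = (\<integral>\<^sup>+t. indicator {0..<f x} t \<partial>lborel)"
      by (intro nn_integral_cong) (auto split: split_indicator)
    also have "\<dots> = ennreal (f x)"
      by (cases "0 \<le> f x") (auto simp: ennreal_neg)
    finally show "ennreal (f x) = (\<integral>\<^sup>+t. (if 0 \<le> t \<and> t < f x then 1 else 0) \<partial>lborel)" by simp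
  qed
  also have "\<dots> = (\<integral>\<^sup>+t. (\<integral>\<^sup>+x. (if 0 \<le> t \<and> t < f x then 1 else 0) \<partial>M) \<partial>lborel)"
    by (rule Fubini'[symmetric]) measurable
  also have "\<dots> = (\<integral>\<^sup>+t. indicator {0..} t * emeasure M {x \<in> space M. t < f x} \<partial>lborel)"
  proof (rule nn_integral_cong)
    fix t :: real
    have "(\<integral>\<^sup>+x. (if 0 \<le> t \<and> t < f x then 1 else 0) \<partial>M) =
        (\<integral>\<^sup>+x. indicator {0..} t * indicator {x \<in> space M. t < f x} x \<partial>M)"
      by (intro nn_integral_cong) (auto split: split_indicator)
    then show "(\<integral>\<^sup>+x. (if 0 \<le> t \<and> t < f x then 1 else 0) \<partial>M) =
        indicator {0..} t * emeasure M {x \<in> space M. t < f x}"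
      by (simp add: nn_integral_cmult)
  qed
  finally show ?thesis .
qed

text \<open>
  An upper set is empty, the whole line or a half-line; a closed half-line is the intersection of open ones.
\<close>

lemma measure_upper_set_mono:
  fixes U :: "real set"
  assumes \<mu>: "finite_measure \<mu>" "sets \<mu> = sets borel" and \<nu>: "finite_measure \<nu>" "sets \<nu> = sets borel"
    and mass: "mass \<mu> \<le> mass \<nu>" and tail: "\<And>k. tail \<mu> k \<le> tail \<nu> k"
    and U: "\<And>x y. x \<in> U \<Longrightarrow> x \<le> y \<Longrightarrow> y \<in> U"
  shows "measure \<mu> U \<le> measure \<nu> U"
proof (cases "U = {} \<or> U = UNIV")
  case True
  then show ?thesis using mass by auto
next
  case False
  then obtain l where l: "l \<notin> U" by auto
  have bdd: "bdd_below U"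
    by (rule bdd_belowI[of _ l]) (use U l in \<open>meson linear\<close>)
  define a where "a = Inf U"
  have "U \<subseteq> {a..}" unfolding a_def using bdd by (auto intro: cInf_lower)
  moreover have "{a<..} \<subseteq> U"
  proof safe
    fix y assume "a < y"
    then obtain x where "x \<in> U" "x < y"
      unfolding a_def using False cInf_less_iff[OF _ bdd] by auto
    then show "y \<in> U" using U by auto
  qed
  ultimately consider "U = {a<..}" | "U = {a..}"
    by (cases "a \<in> U") (force simp: order.order_iff_strict)+
  then show ?thesis
  proof cases
    case 1
    then show ?thesis using tail by simp
  next
    case 2
    have lim: "(\<lambda>n. tail \<kappa> (a - 1 / real (Suc n))) \<longlonglongrightarrow> measure \<kappa> {a..}"
      if \<kappa>: "finite_measure \<kappa>" "sets \<kappa> = sets borel" for \<kappa>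
    proof -
      interpret finite_measure \<kappa> by fact
      have "(\<lambda>n. tail \<kappa> (a - 1 / real (Suc n))) \<longlonglongrightarrow> measure \<kappa> (\<Inter>n. {a - 1 / real (Suc n)<..})"
      proof (rule finite_Lim_measure_decseq)
        show "decseq (\<lambda>n. {a - 1 / real (Suc n)<..})"
        proof (rule decseq_SucI)
          fix n
          have "1 / real (Suc (Suc n)) \<le> 1 / real (Suc n)"
            by (intro divide_left_mono) auto
          then show "{a - 1 / real (Suc (Suc n))<..} \<le> {a - 1 / real (Suc n)<..}"
            by auto
        qed
      qed (auto simp: \<kappa>)
      also have "(\<Inter>n. {a - 1 / real (Suc n)<..}) = {a..}"
      proof safe
        fix y assume y: "y \<in> (\<Inter>n. {a - 1 / real (Suc n)<..})"
        show "a \<le> y"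
        proof (rule ccontr)
          assume "\<not> a \<le> y"
          then obtain n where "1 / real (Suc n) < a - y"
            using nat_approx_posE[of "a - y"] by auto
          moreover have "a - 1 / real (Suc n) < y" using y by auto
          ultimately show False by linarith
        qed
      next
        fix y n assume "a \<le> y"
        moreover have "0 < 1 / real (Suc n)" by simp
        ultimately show "a - 1 / real (Suc n) < y" by linarith
      qed
      finally show ?thesis .
    qed
    show ?thesis
      unfolding 2 by (rule LIMSEQ_le[OF lim[OF \<mu>] lim[OF \<nu>]]) (use tail in auto)
  qed
qed

text \<open>
  The superlevel sets of a monotone function are upper sets and the sublevel sets are their complements. So the
  layer cake formula compares the positive parts, and, the masses being equal, the negative parts.
\<close>

lemma preceq_StoI:
  assumes \<mu>: "\<mu> \<in> \<M>" and \<nu>: "\<nu> \<in> \<M>"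
    and mass: "mass \<mu> = mass \<nu>" and tail: "\<And>k. tail \<mu> k \<le> tail \<nu> k"
  shows "preceq {Sto} \<mu> \<nu>"
  unfolding preceq_def
proof safe
  fix \<phi> assume "\<phi> \<in> (\<Inter>r\<in>{Sto}. test_functions r)"
  then have lg: "\<phi> \<in> linear_growth_functions" and mono: "mono \<phi>" by auto
  interpret \<mu>: finite_measure \<mu> by (rule first_momentD[OF \<mu>])
  interpret \<nu>: finite_measure \<nu> by (rule first_momentD[OF \<nu>])
  note [simp] = first_momentD(4)[OF \<mu>] first_momentD(4)[OF \<nu>] first_momentD(1)[OF \<mu>] first_momentD(1)[OF \<nu>]
  have [measurable]: "\<phi> \<in> borel_measurable borel" using lg by (simp add: linear_growth_functions_def)
  have m: "\<phi> \<in> borel_measurable \<mu>" "\<phi> \<in> borel_measurable \<nu>"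
    by (simp_all cong: measurable_cong_sets)
  have up: "measure \<mu> U \<le> measure \<nu> U" if "\<And>x y. x \<in> U \<Longrightarrow> x \<le> y \<Longrightarrow> y \<in> U" for U
    using measure_upper_set_mono[OF first_momentD(2,1)[OF \<mu>] first_momentD(2,1)[OF \<nu>], of U] mass tail that by simp
  have pos: "(\<integral>\<^sup>+x. ennreal (\<phi> x) \<partial>\<mu>) \<le> (\<integral>\<^sup>+x. ennreal (\<phi> x) \<partial>\<nu>)"
  proof -
    have "measure \<mu> {x. t < \<phi> x} \<le> measure \<nu> {x. t < \<phi> x}" for t
      by (rule up) (use mono in \<open>auto simp: mono_def intro: less_le_trans\<close>)
    then show ?thesis
      using m by (simp add: nn_integral_layer_cake \<mu>.sigma_finite_measure_axioms \<nu>.sigma_finite_measure_axioms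
        \<mu>.emeasure_eq_measure \<nu>.emeasure_eq_measure nn_integral_mono mult_left_mono ennreal_leI)
  qed
  have neg: "(\<integral>\<^sup>+x. ennreal (- \<phi> x) \<partial>\<nu>) \<le> (\<integral>\<^sup>+x. ennreal (- \<phi> x) \<partial>\<mu>)"
  proof -
    have "measure \<nu> {x. t < - \<phi> x} \<le> measure \<mu> {x. t < - \<phi> x}" for t
    proof -
      have "measure \<mu> (- {x. t < - \<phi> x}) \<le> measure \<nu> (- {x. t < - \<phi> x})"
        by (rule up) (use mono in \<open>force simp: mono_def not_less\<close>)
      moreover have "{x. t < - \<phi> x} \<in> sets borel" by measurable
      ultimately show ?thesis
        using \<mu>.finite_measure_compl[of "{x. t < - \<phi> x}"] \<nu>.finite_measure_compl[of "{x. t < - \<phi> x}"] mass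
        by (simp add: Compl_eq_Diff_UNIV)
    qed
    then show ?thesis
      using m by (simp add: nn_integral_layer_cake \<mu>.sigma_finite_measure_axioms \<nu>.sigma_finite_measure_axioms
        \<mu>.emeasure_eq_measure \<nu>.emeasure_eq_measure nn_integral_mono mult_left_mono ennreal_leI)
  qed
  have "integrable \<mu> \<phi>" "integrable \<nu> \<phi>" using integrable_linear_growth \<mu> \<nu> lg by auto
  then show "(\<integral>x. \<phi> x \<partial>\<mu>) \<le> (\<integral>x. \<phi> x \<partial>\<nu>)"
    using pos neg
    by (auto simp: real_lebesgue_integral_def real_integrable_def less_top intro!: diff_mono enn2real_mono)
qed

text \<open>
  A convex function of linear growth is Lipschitz, hence a pointwise limit of interpolating polygons with a
  common linear bound. The integral of a polygon is a function of mass and mean plus a non-negative combination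
  of values of the call function.
\<close>

lemma preceq_CvxI:
  assumes \<mu>: "\<mu> \<in> \<M>" and \<nu>: "\<nu> \<in> \<M>"
    and mass: "mass \<mu> = mass \<nu>" and mean: "mean \<mu> = mean \<nu>" and call: "\<And>k. call \<mu> k \<le> call \<nu> k"
  shows "preceq {Cvx} \<mu> \<nu>"
  unfolding preceq_def
proof safe
  fix \<phi> assume "\<phi> \<in> (\<Inter>r\<in>{Cvx}. test_functions r)"
  then have cvx: "convex_on UNIV \<phi>" and "\<phi> \<in> linear_growth_functions" by auto
  then obtain L where bound: "\<And>x. \<bar>\<phi> x\<bar> \<le> L * (1 + \<bar>x\<bar>)" by (auto simp: linear_growth_functions_def)
  have lip: "\<And>x y. \<bar>\<phi> x - \<phi> y\<bar> \<le> L * \<bar>x - y\<bar>"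
    by (rule convex_linear_growth_lipschitz[OF cvx bound])
  have L0: "0 \<le> L" using bound[of 0] by simp
  have poly: "(\<integral>x. polygon \<phi> a h n x \<partial>\<mu>) \<le> (\<integral>x. polygon \<phi> a h n x \<partial>\<nu>) \<and>
      integrable \<mu> (polygon \<phi> a h n) \<and> integrable \<nu> (polygon \<phi> a h n)" if h: "0 < h" for a h n
  proof (induction n)
    case 0
    have "(\<integral>x. polygon \<phi> a h 0 x \<partial>\<kappa>) =
        mass \<kappa> * \<phi> a + (\<phi> (a + h) - \<phi> a) / h * (mean \<kappa> - mass \<kappa> * a)" if "\<kappa> \<in> \<M>" for \<kappa>
      using that by (simp add: first_momentD(4))
    moreover have "integrable \<kappa> (polygon \<phi> a h 0)" if "\<kappa> \<in> \<M>" for \<kappa>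
    proof -
      have "integrable \<kappa> (\<lambda>x. \<phi> a + (\<phi> (a + h) - \<phi> a) / h * (x - a))"
        using that by (intro Bochner_Integration.integrable_add integrable_mult_right
          Bochner_Integration.integrable_diff) auto
      then show ?thesis by (simp add: fun_eq_iff cong: Bochner_Integration.integrable_cong)
    qed
    ultimately show ?case
      using \<mu> \<nu> mass mean by (simp add: first_momentD(4)[OF \<mu>] first_momentD(4)[OF \<nu>])
  next
    case (Suc n)
    define w where "w = (\<phi> (a + (real n + 2) * h) - \<phi> (a + (real n + 1) * h)) / h
      - (\<phi> (a + (real n + 1) * h) - \<phi> (a + real n * h)) / h"
    define k where "k = a + (real n + 1) * h"
    have "0 \<le> w"
      using convex_slope_mono[OF cvx, of "a + real n * h" k k "a + (real n + 2) * h"] h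
      by (simp add: w_def k_def algebra_simps)
    then have "w * call \<mu> k \<le> w * call \<nu> k" by (intro mult_left_mono call)
    moreover have eq: "polygon \<phi> a h (Suc n) = (\<lambda>x. polygon \<phi> a h n x + w * max (x - k) 0)"
      by (simp add: w_def k_def fun_eq_iff)
    moreover have "(\<integral>x. polygon \<phi> a h n x + w * max (x - k) 0 \<partial>\<kappa>) = (\<integral>x. polygon \<phi> a h n x \<partial>\<kappa>) + w * call \<kappa> k"
      if "\<kappa> \<in> \<M>" "integrable \<kappa> (polygon \<phi> a h n)" for \<kappa>
      using that by (simp add: call_def)
    ultimately show ?case
      using Suc \<mu> \<nu> by (simp del: polygon.simps flip: call_def)
  qed
  \<comment> \<open>With $N = i + 1$, the grid of width $1/N$ covers $[-N, N]$; it has $2 N^2$ cells.\<close>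
  define P where "P i = polygon \<phi> (- real (Suc i)) (1 / real (Suc i)) (2 * Suc i * Suc i - 1)" for i
  have err: "\<bar>P i x - \<phi> x\<bar> \<le> 2 * L * (1 / real (Suc i) + max (- real (Suc i) - x) 0 + max (x - real (Suc i)) 0)" for i x
  proof -
    have "real (2 * Suc i * Suc i - 1) + 1 = 2 * real (Suc i) * real (Suc i)"
      by (simp add: of_nat_diff algebra_simps)
    then have last: "- real (Suc i) + (real (2 * Suc i * Suc i - 1) + 1) * (1 / real (Suc i)) = real (Suc i)"
      by simp
    have "0 < 1 / real (Suc i)" by simp
    from polygon_error[OF this lip, of "- real (Suc i)" "2 * Suc i * Suc i - 1" x]
    show ?thesis unfolding P_def last .
  qed
  have lim: "(\<lambda>i. P i x) \<longlonglongrightarrow> \<phi> x" for x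
  proof -
    have "(\<lambda>i. P i x - \<phi> x) \<longlonglongrightarrow> 0"
    proof (rule Lim_null_comparison)
      show "(\<lambda>i. 2 * L * (1 / real (Suc i))) \<longlonglongrightarrow> 0"
        by (intro tendsto_mult_right_zero LIMSEQ_Suc lim_1_over_n)
      show "\<forall>\<^sub>F i in sequentially. norm (P i x - \<phi> x) \<le> 2 * L * (1 / real (Suc i))"
        using eventually_ge_at_top[of "nat \<lceil>\<bar>x\<bar>\<rceil>"]
      proof eventually_elim
        case (elim i)
        then have "\<bar>x\<bar> \<le> real (Suc i)" by linarith
        then have "max (- real (Suc i) - x) 0 = 0" "max (x - real (Suc i)) 0 = 0" by auto
        then show ?case using err[of i x] by simp
      qed
    qed
    then show ?thesis by (simp add: LIM_zero_iff)
  qed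
  have dom: "norm (P i x) \<le> \<bar>\<phi> x\<bar> + 2 * L * (1 + \<bar>x\<bar>)" for i x
  proof -
    have "1 / real (Suc i) \<le> 1" by simp
    moreover have "max (- real (Suc i) - x) 0 + max (x - real (Suc i)) 0 \<le> \<bar>x\<bar>" by auto
    ultimately have "2 * L * (1 / real (Suc i) + max (- real (Suc i) - x) 0 + max (x - real (Suc i)) 0)
        \<le> 2 * L * (1 + \<bar>x\<bar>)"
      using L0 by (intro mult_left_mono) linarith+
    then show ?thesis using err[of i x] by auto
  qed
  have conv: "(\<lambda>i. \<integral>x. P i x \<partial>\<kappa>) \<longlonglongrightarrow> (\<integral>x. \<phi> x \<partial>\<kappa>)" if \<kappa>: "\<kappa> \<in> \<M>" and int: "\<And>i. integrable \<kappa> (P i)" for \<kappa>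
  proof (rule integral_dominated_convergence[where w = "\<lambda>x. \<bar>\<phi> x\<bar> + 2 * L * (1 + \<bar>x\<bar>)"])
    have "integrable \<kappa> \<phi>" using integrable_linear_growth[OF \<kappa>] \<open>\<phi> \<in> linear_growth_functions\<close> by simp
    then show "\<phi> \<in> borel_measurable \<kappa>" "integrable \<kappa> (\<lambda>x. \<bar>\<phi> x\<bar> + 2 * L * (1 + \<bar>x\<bar>))"
      using integrable_call(5)[OF \<kappa>, of 1] first_momentD(3)[OF \<kappa>] by auto
  qed (use int lim dom in auto)
  have P: "(\<integral>x. P i x \<partial>\<mu>) \<le> (\<integral>x. P i x \<partial>\<nu>)" "integrable \<mu> (P i)" "integrable \<nu> (P i)" for i
  proof -
    have "0 < 1 / real (Suc i)" by simp
    from poly[OF this] show "(\<integral>x. P i x \<partial>\<mu>) \<le> (\<integral>x. P i x \<partial>\<nu>)" "integrable \<mu> (P i)" "integrable \<nu> (P i)"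
      unfolding P_def by blast+
  qed
  show "(\<integral>x. \<phi> x \<partial>\<mu>) \<le> (\<integral>x. \<phi> x \<partial>\<nu>)"
    by (rule LIMSEQ_le[OF conv[OF \<mu> P(2)] conv[OF \<nu> P(3)]]) (use P(1) in auto)
qed

section \<open>Measures with prescribed tail or call function\<close>

lemma measure_of_tail:
  fixes G :: "real \<Rightarrow> real"
  assumes anti: "antimono G" and cont: "\<And>x. continuous (at_right x) G"
    and top: "(G \<longlongrightarrow> 0) at_top" and bot: "(G \<longlongrightarrow> m) at_bot"
  obtains \<mu> where "finite_measure \<mu>" "sets \<mu> = sets borel" "mass \<mu> = m" "\<And>k. tail \<mu> k = G k"
proof -
  define \<mu> where "\<mu> = interval_measure (\<lambda>x. - G x)"
  have Ioc: "emeasure \<mu> {a<..b} = ennreal (G a - G b)" if "a \<le> b" for a b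
    unfolding \<mu>_def using that anti cont
    by (subst emeasure_interval_measure_Ioc) (auto simp: antimono_def intro!: continuous_minus)
  have nn: "0 \<le> G k" for k
    by (rule tendsto_upperbound[OF top]) (use anti in \<open>auto simp: antimono_def eventually_at_top_linorder\<close>)
  have Ioi: "emeasure \<mu> {k<..} = ennreal (G k)" for k
  proof (rule LIMSEQ_unique)
    have "(\<lambda>n. emeasure \<mu> {k<..k + real n}) \<longlonglongrightarrow> emeasure \<mu> (\<Union>n. {k<..k + real n})"
      by (rule Lim_emeasure_incseq) (auto simp: \<mu>_def incseq_def)
    also have "(\<Union>n. {k<..k + real n}) = {k<..}"
    proof safe
      fix y assume "k < y"
      moreover obtain n where "y - k \<le> real n" using real_arch_simple by blast
      ultimately show "y \<in> (\<Union>n. {k<..k + real n})" by (auto intro!: exI[of _ n])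
    qed auto
    finally show "(\<lambda>n. emeasure \<mu> {k<..k + real n}) \<longlonglongrightarrow> emeasure \<mu> {k<..}" .
    have "filterlim (\<lambda>n. k + real n) at_top sequentially"
      by (rule filterlim_tendsto_add_at_top[OF tendsto_const filterlim_real_sequentially])
    from filterlim_compose[OF top this] have "(\<lambda>n. G k - G (k + real n)) \<longlonglongrightarrow> G k - 0"
      by (intro tendsto_diff tendsto_const)
    then show "(\<lambda>n. emeasure \<mu> {k<..k + real n}) \<longlonglongrightarrow> ennreal (G k)"
      by (simp add: Ioc tendsto_ennrealI)
  qed
  have UNIV: "emeasure \<mu> UNIV = ennreal m"
  proof (rule LIMSEQ_unique)
    have "(\<lambda>n. emeasure \<mu> {- real n<..}) \<longlonglongrightarrow> emeasure \<mu> (\<Union>n. {- real n<..})"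
      by (rule Lim_emeasure_incseq) (auto simp: \<mu>_def incseq_def)
    also have "(\<Union>n. {- real n<..}) = UNIV"
      using reals_Archimedean2 by (auto simp: minus_less_iff)
    finally show "(\<lambda>n. emeasure \<mu> {- real n<..}) \<longlonglongrightarrow> emeasure \<mu> UNIV" .
    have "filterlim (\<lambda>n. - real n) at_bot sequentially"
      by (simp add: filterlim_uminus_at_top[symmetric] filterlim_real_sequentially)
    from filterlim_compose[OF bot this]
    show "(\<lambda>n. emeasure \<mu> {- real n<..}) \<longlonglongrightarrow> ennreal m"
      by (simp add: Ioi tendsto_ennrealI)
  qed
  have "0 \<le> m"
    by (rule tendsto_lowerbound[OF bot]) (auto simp: nn)
  show thesis
  proof
    show "finite_measure \<mu>"
      by (rule finite_measureI) (use UNIV in \<open>simp add: \<mu>_def\<close>)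
    show "sets \<mu> = sets borel" by (simp add: \<mu>_def)
    show "mass \<mu> = m" "tail \<mu> k = G k" for k
      using UNIV Ioi[of k] nn[of k] \<open>0 \<le> m\<close> by (simp_all add: measure_def)
  qed
qed

text \<open>
  Each halving of the intervals halves the bound on $\delta$, since the increments of $F$ add up to the same total.
\<close>

lemma additive_interval_function_zero:
  fixes \<delta> :: "real \<Rightarrow> real \<Rightarrow> real"
  assumes add: "\<And>u v w. u \<le> v \<Longrightarrow> v \<le> w \<Longrightarrow> \<delta> u w = \<delta> u v + \<delta> v w"
    and bound: "\<And>u v. u \<le> v \<Longrightarrow> \<bar>\<delta> u v\<bar> \<le> (v - u) * (F u - F v)"
    and "a \<le> b"
  shows "\<delta> a b = 0"
proof -
  have *: "\<bar>\<delta> u v\<bar> \<le> (v - u) * (F u - F v) * (1 / 2) ^ n" if "u \<le> v" for u v n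
    using that
  proof (induction n arbitrary: u v)
    case 0
    then show ?case using bound by simp
  next
    case (Suc n)
    define w where "w = (u + v) / 2"
    have w: "u \<le> w" "w \<le> v" and half: "w - u = (v - u) / 2" "v - w = (v - u) / 2"
      using Suc.prems by (auto simp: w_def field_simps)
    have "\<bar>\<delta> u v\<bar> \<le> \<bar>\<delta> u w\<bar> + \<bar>\<delta> w v\<bar>" using add[OF w] by simp
    also have "\<dots> \<le> (w - u) * (F u - F w) * (1 / 2) ^ n + (v - w) * (F w - F v) * (1 / 2) ^ n"
      by (intro add_mono Suc.IH w)
    also have "\<dots> = (v - u) / 2 * ((F u - F w) + (F w - F v)) * (1 / 2) ^ n"
      unfolding half by (simp only: distrib_left distrib_right)
    also have "\<dots> = (v - u) * (F u - F v) * (1 / 2) ^ Suc n"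
      by simp
    finally show ?case .
  qed
  have "(\<lambda>n. (b - a) * (F a - F b) * (1 / 2) ^ n) \<longlonglongrightarrow> 0"
    by (intro tendsto_mult_right_zero LIMSEQ_realpow_zero) auto
  then have "\<bar>\<delta> a b\<bar> \<le> 0"
    by (rule LIMSEQ_le_const) (use *[OF \<open>a \<le> b\<close>] in auto)
  then show ?thesis by simp
qed

text \<open>
  The function $G$ is minus the right derivative of $C$, obtained as a supremum of difference quotients. These
  are continuous in the base point, so $G$ is lower semicontinuous; being non-increasing, it is continuous from the right.
\<close>

lemma convex_neg_right_derivative:
  fixes C :: "real \<Rightarrow> real"
  assumes C: "convex_on UNIV C"
  obtains G where "antimono G" "\<And>x. continuous (at_right x) G"
    "\<And>u v. u < v \<Longrightarrow> (v - u) * G v \<le> C u - C v" "\<And>u v. u < v \<Longrightarrow> C u - C v \<le> (v - u) * G u"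
proof -
  define q where "q h x = (C x - C (x + h)) / h" for h x
  define G where "G x = (SUP h\<in>{0<..}. q h x)" for x
  have q_le: "q h v \<le> (C u - C v) / (v - u)" if "0 < h" "u < v" for h u v
    using convex_slope_mono[OF C \<open>u < v\<close> order_refl, of "v + h"] that
    by (simp add: q_def) (smt (verit, best) minus_divide_left minus_diff_eq)
  have bdd: "bdd_above ((\<lambda>h. q h x) ` {0<..})" for x
    using q_le[of _ "x - 1" x] by (intro bdd_aboveI[of _ "C (x - 1) - C x"]) auto
  have qG: "q h x \<le> G x" if "0 < h" for h x
    unfolding G_def using that by (intro cSUP_upper[OF _ bdd]) auto
  have G_least: "G x \<le> c" if "\<And>h. 0 < h \<Longrightarrow> q h x \<le> c" for c x
    unfolding G_def using that by (intro cSUP_least) auto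
  have right: "C u - C v \<le> (v - u) * G u" if "u < v" for u v
    using qG[of "v - u" u] that by (simp add: q_def field_simps)
  have left: "(v - u) * G v \<le> C u - C v" if "u < v" for u v
    using G_least[OF q_le[OF _ that]] that by (simp add: field_simps)
  have anti: "antimono G"
  proof (rule antimonoI)
    fix u v :: real assume "u \<le> v"
    show "G v \<le> G u"
    proof (cases "u = v")
      case False
      then have "(v - u) * G v \<le> (v - u) * G u"
        using left[of u v] right[of u v] \<open>u \<le> v\<close> by linarith
      then show ?thesis using False \<open>u \<le> v\<close> by simp
    qed simp
  qed
  have contC: "continuous_on UNIV C" by (rule convex_on_continuous[OF open_UNIV C])
  have "continuous (at_right x) G" for x
    unfolding continuous_within
  proof (rule order_tendstoI)
    fix c assume c: "G x < c"
    show "\<forall>\<^sub>F y in at_right x. G y < c"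
      using eventually_at_right_less[of x]
    proof eventually_elim
      case (elim y)
      then show ?case using antimonoD[OF anti, of x y] c by simp
    qed
  next
    fix c assume "c < G x"
    then have "\<exists>h\<in>{0<..}. c < q h x"
      unfolding G_def by (subst (asm) less_cSUP_iff[OF _ bdd]) auto
    then obtain h where h: "0 < h" "c < q h x" by auto
    have "continuous_on UNIV (q h)"
      unfolding q_def using h(1)
      by (auto intro!: continuous_intros continuous_on_compose2[OF contC])
    then have "(q h \<longlongrightarrow> q h x) (at_right x)"
      by (simp add: continuous_on_def filterlim_at_split)
    then have "\<forall>\<^sub>F y in at_right x. c < q h y"
      using h(2) by (rule order_tendstoD)
    then show "\<forall>\<^sub>F y in at_right x. c < G y"
      by eventually_elim (use qG[OF h(1)] less_le_trans in blast)
  qed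
  with that anti left right show thesis by blast
qed

lemma filterlim_shift_at_bot: "LIM x at_bot. x + c :> at_bot" for c :: real
  unfolding filterlim_at_bot
proof
  fix Z show "\<forall>\<^sub>F x in at_bot. x + c \<le> Z"
    using eventually_le_at_bot[of "Z - c"] by eventually_elim simp
qed

lemma slope_limits:
  fixes C G :: "real \<Rightarrow> real"
  assumes left: "\<And>u v. u < v \<Longrightarrow> (v - u) * G v \<le> C u - C v" and right: "\<And>u v. u < v \<Longrightarrow> C u - C v \<le> (v - u) * G u"
    and top: "(C \<longlongrightarrow> 0) at_top" and bot: "((\<lambda>k. C k + m * k) \<longlongrightarrow> b) at_bot"
  shows "(G \<longlongrightarrow> 0) at_top" "(G \<longlongrightarrow> m) at_bot"
proof -
  have squeeze: "C x - C (x + 1) \<le> G x" "G x \<le> C (x - 1) - C x" for x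
    using right[of x "x + 1"] left[of "x - 1" x] by simp_all
  have shift_top: "LIM x at_top. x + c :> at_top" for c :: real
    using filterlim_tendsto_add_at_top[OF tendsto_const[of c] filterlim_ident] by (simp add: add.commute)
  show "(G \<longlongrightarrow> 0) at_top"
  proof (rule tendsto_sandwich)
    have lim: "((\<lambda>x. C (x + c) - C (x + d)) \<longlongrightarrow> 0 - 0) at_top" for c d
      by (intro tendsto_diff filterlim_compose[OF top shift_top])
    show "((\<lambda>x. C x - C (x + 1)) \<longlongrightarrow> 0) at_top" using lim[of 0 1] by simp
    show "((\<lambda>x. C (x - 1) - C x) \<longlongrightarrow> 0) at_top" using lim[of "- 1" 0] by simp
  qed (simp_all add: squeeze)
  show "(G \<longlongrightarrow> m) at_bot"
  proof (rule tendsto_sandwich)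
    have "((\<lambda>x. (C (x + c) + m * (x + c)) - (C (x + d) + m * (x + d)) + m * (d - c)) \<longlongrightarrow> b - b + m * (d - c)) at_bot"
      for c d
      by (intro tendsto_add tendsto_diff tendsto_const filterlim_compose[OF bot filterlim_shift_at_bot])
    moreover have "(C (x + c) + m * (x + c)) - (C (x + d) + m * (x + d)) + m * (d - c) = C (x + c) - C (x + d)"
      for x c d
      by (simp add: algebra_simps)
    ultimately have lim: "((\<lambda>x. C (x + c) - C (x + d)) \<longlongrightarrow> m * (d - c)) at_bot" for c d
      by simp
    show "((\<lambda>x. C x - C (x + 1)) \<longlongrightarrow> m) at_bot" using lim[of 0 1] by simp
    show "((\<lambda>x. C (x - 1) - C x) \<longlongrightarrow> m) at_bot" using lim[of "- 1" 0] by simp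
  qed (simp_all add: squeeze)
qed

text \<open>
  Minus the right derivative of $C$ is the tail of a measure $\mu$ of mass $m$. Both $C(u) - C(v)$ and
  the integral of the tail over $[u, v]$ are additive in the interval and lie between
  $(v - u) G(v)$ and $(v - u) G(u)$, so they coincide. Monotone convergence as $v \to \infty$ and as
  $u \to -\infty$ then yields the integrals of $(y - k)^+$ and $(k - y)^+$, and with them the first moment.
\<close>

lemma measure_of_call:
  assumes C: "convex_on UNIV C" and top: "(C \<longlongrightarrow> 0) at_top"
    and bot: "((\<lambda>k. C k + m * k) \<longlongrightarrow> b) at_bot"
  obtains \<mu> where "\<mu> \<in> \<M>" "mass \<mu> = m" "mean \<mu> = b" "\<And>k. call \<mu> k = C k"
proof -
  obtain G where anti: "antimono G" and rc: "\<And>x. continuous (at_right x) G"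
    and left: "\<And>u v. u < v \<Longrightarrow> (v - u) * G v \<le> C u - C v" and right: "\<And>u v. u < v \<Longrightarrow> C u - C v \<le> (v - u) * G u"
    using convex_neg_right_derivative[OF C] by blast
  note Gtop = slope_limits(1)[OF left right top bot] and Gbot = slope_limits(2)[OF left right top bot]
  obtain \<mu> where fin: "finite_measure \<mu>" and sets: "sets \<mu> = sets borel"
    and mass: "mass \<mu> = m" and tail: "\<And>k. tail \<mu> k = G k"
    using measure_of_tail[OF anti rc Gtop Gbot] by blast
  interpret finite_measure \<mu> by fact
  have space: "space \<mu> = UNIV" using sets_eq_imp_space_eq[OF sets] by simp
  have [measurable_cong]: "sets \<mu> = sets borel" by fact
  have clamped: "clamped \<mu> u v = C u - C v" if "u \<le> v" for u v
  proof -
    have "clamped \<mu> u v - (C u - C v) = 0"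
    proof (rule additive_interval_function_zero[where F = G, OF _ _ that])
      fix u v w :: real assume *: "u \<le> v" "v \<le> w"
      have "clamped \<mu> u w = (\<integral>y. (min (max y u) v - u) + (min (max y v) w - v) \<partial>\<mu>)"
        unfolding clamped_def using * by (intro Bochner_Integration.integral_cong) auto
      also have "\<dots> = clamped \<mu> u v + clamped \<mu> v w"
        unfolding clamped_def using * by (intro Bochner_Integration.integral_add integrable_clamped fin sets)
      finally show "clamped \<mu> u w - (C u - C w) = clamped \<mu> u v - (C u - C v) + (clamped \<mu> v w - (C v - C w))"
        by simp
    next
      fix u v :: real assume "u \<le> v"
      then show "\<bar>clamped \<mu> u v - (C u - C v)\<bar> \<le> (v - u) * (G u - G v)"
        using clamped_bounds[OF fin sets, of u v] left[of u v] right[of u v]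
        by (cases "u = v") (auto simp: tail algebra_simps abs_le_iff)
    qed
    then show ?thesis by simp
  qed
  have up: "has_bochner_integral \<mu> (\<lambda>y. max (y - k) 0) (C k)" for k
  proof (rule has_bochner_integral_monotone_convergence)
    show "integrable \<mu> (\<lambda>y. min (max y k) (k + real n) - k)" for n
      by (rule integrable_clamped[OF fin sets]) simp
    show "AE y in \<mu>. mono (\<lambda>n. min (max y k) (k + real n) - k)"
      by (rule AE_I2) (auto simp: mono_def min_def)
    show "AE y in \<mu>. (\<lambda>n. min (max y k) (k + real n) - k) \<longlonglongrightarrow> max (y - k) 0"
    proof (rule AE_I2)
      fix y :: real
      show "(\<lambda>n. min (max y k) (k + real n) - k) \<longlonglongrightarrow> max (y - k) 0"
      proof (rule tendsto_eventually, rule eventually_mono[OF eventually_ge_at_top[of "nat \<lceil>y - k\<rceil>"]])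
        fix n assume "nat \<lceil>y - k\<rceil> \<le> n"
        then have "y - k \<le> real n" by linarith
        then show "min (max y k) (k + real n) - k = max (y - k) 0" by auto
      qed
    qed
    have "filterlim (\<lambda>n. k + real n) at_top sequentially"
      by (rule filterlim_tendsto_add_at_top[OF tendsto_const filterlim_real_sequentially])
    from filterlim_compose[OF top this] have "(\<lambda>n. C k - C (k + real n)) \<longlonglongrightarrow> C k - 0"
      by (intro tendsto_diff tendsto_const)
    then show "(\<lambda>n. \<integral>y. min (max y k) (k + real n) - k \<partial>\<mu>) \<longlonglongrightarrow> C k"
      using clamped[of k "k + real _"] by (simp add: clamped_def)
  qed simp
  have down: "has_bochner_integral \<mu> (\<lambda>y. max (k - y) 0) (C k + m * k - b)" for k
  proof (rule has_bochner_integral_monotone_convergence)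
    have int: "integrable \<mu> (\<lambda>y. min (max y (k - real n)) k - (k - real n))" for n
      by (rule integrable_clamped[OF fin sets]) simp
    then show "integrable \<mu> (\<lambda>y. real n - (min (max y (k - real n)) k - (k - real n)))" for n
      by (intro Bochner_Integration.integrable_diff[OF integrable_const])
    show "AE y in \<mu>. mono (\<lambda>n. real n - (min (max y (k - real n)) k - (k - real n)))"
      by (rule AE_I2) (auto simp: mono_def min_def max_def)
    show "AE y in \<mu>. (\<lambda>n. real n - (min (max y (k - real n)) k - (k - real n))) \<longlonglongrightarrow> max (k - y) 0"
    proof (rule AE_I2)
      fix y :: real
      show "(\<lambda>n. real n - (min (max y (k - real n)) k - (k - real n))) \<longlonglongrightarrow> max (k - y) 0"
      proof (rule tendsto_eventually, rule eventually_mono[OF eventually_ge_at_top[of "nat \<lceil>k - y\<rceil>"]])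
        fix n assume "nat \<lceil>k - y\<rceil> \<le> n"
        then have "k - y \<le> real n" by linarith
        then show "real n - (min (max y (k - real n)) k - (k - real n)) = max (k - y) 0" by auto
      qed
    qed
    have "filterlim (\<lambda>n. - real n) at_bot sequentially"
      by (simp add: filterlim_uminus_at_top[symmetric] filterlim_real_sequentially)
    from filterlim_compose[OF bot filterlim_compose[OF filterlim_shift_at_bot[of k] this]]
    have "(\<lambda>n. C k + m * k - (C (- real n + k) + m * (- real n + k))) \<longlonglongrightarrow> C k + m * k - b"
      by (intro tendsto_diff tendsto_const)
    moreover have "(\<integral>y. real n - (min (max y (k - real n)) k - (k - real n)) \<partial>\<mu>)
        = C k + m * k - (C (- real n + k) + m * (- real n + k))" for n
    proof -
      have "(\<integral>y. real n - (min (max y (k - real n)) k - (k - real n)) \<partial>\<mu>) = real n * m - clamped \<mu> (k - real n) k"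
        unfolding clamped_def using int[of n]
        by (subst Bochner_Integration.integral_diff) (auto simp: space mass)
      then show ?thesis by (simp add: clamped algebra_simps)
    qed
    ultimately show "(\<lambda>n. \<integral>y. real n - (min (max y (k - real n)) k - (k - real n)) \<partial>\<mu>) \<longlonglongrightarrow> C k + m * k - b"
      by simp
  qed simp
  have "has_bochner_integral \<mu> (\<lambda>y. max (y - 0) 0 + max (0 - y) 0) (C 0 + (C 0 + m * 0 - b))"
    by (rule has_bochner_integral_add[OF up down])
  also have "(\<lambda>y. max (y - 0) 0 + max (0 - y) 0) = (\<lambda>y::real. \<bar>y\<bar>)" by (auto simp: fun_eq_iff)
  finally have M: "\<mu> \<in> \<M>"
    by (intro first_momentI sets fin) (simp add: has_bochner_integral_iff)
  have "has_bochner_integral \<mu> (\<lambda>y. max (y - 0) 0 - max (0 - y) 0) (C 0 - (C 0 + m * 0 - b))"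
    by (rule has_bochner_integral_diff[OF up down])
  also have "(\<lambda>y. max (y - 0) 0 - max (0 - y) 0) = (\<lambda>y::real. y)" by (auto simp: fun_eq_iff)
  finally have "mean \<mu> = b" by (simp add: has_bochner_integral_iff)
  moreover have "call \<mu> k = C k" for k
    using up[of k] by (simp add: call_def has_bochner_integral_iff)
  ultimately show thesis using that M mass by blast
qed

section \<open>Factoring the relations with two subscripts\<close>

lemma tail_antimono:
  assumes "\<mu> \<in> \<M>"
  shows "antimono (tail \<mu>)"
  by (rule antimonoI)
    (use first_momentD[OF assms] in \<open>auto intro!: finite_measure.finite_measure_mono\<close>)

lemma tail_continuous_at_right:
  assumes \<mu>: "\<mu> \<in> \<M>"
  shows "continuous (at_right x) (tail \<mu>)"
  unfolding continuous_within
proof (rule order_tendstoI)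
  fix c assume c: "tail \<mu> x < c"
  show "\<forall>\<^sub>F y in at_right x. tail \<mu> y < c"
    using eventually_at_right_less[of x]
  proof eventually_elim
    case (elim y)
    then show ?case using antimonoD[OF tail_antimono[OF \<mu>], of x y] c by simp
  qed
next
  fix c assume "c < tail \<mu> x"
  then have "\<forall>\<^sub>F n in sequentially. c < tail \<mu> (x + 1 / real (Suc n))"
    by (rule order_tendstoD(1)[OF tail_right_continuous[OF first_momentD(2,1)[OF \<mu>]]])
  then obtain n where n: "c < tail \<mu> (x + 1 / real (Suc n))"
    by (auto dest: eventually_happens)
  show "\<forall>\<^sub>F y in at_right x. c < tail \<mu> y"
    unfolding eventually_at_right_field
  proof (intro exI[of _ "x + 1 / real (Suc n)"] conjI allI impI)
    fix y assume "y < x + 1 / real (Suc n)"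
    then show "c < tail \<mu> y"
      using antimonoD[OF tail_antimono[OF \<mu>], of y "x + 1 / real (Suc n)"] n by simp
  qed simp
qed

lemma tail_limits:
  assumes \<mu>: "\<mu> \<in> \<M>"
  shows "(tail \<mu> \<longlongrightarrow> 0) at_top" "(tail \<mu> \<longlongrightarrow> mass \<mu>) at_bot"
proof -
  have *: "(v - u) * tail \<mu> v \<le> call \<mu> u - call \<mu> v" "call \<mu> u - call \<mu> v \<le> (v - u) * tail \<mu> u" if "u < v" for u v
    using clamped_bounds(1,2)[OF first_momentD(2,1)[OF \<mu>], of u v] call_diff_eq_clamped[OF \<mu>, of u v] that by simp_all
  show "(tail \<mu> \<longlongrightarrow> 0) at_top" "(tail \<mu> \<longlongrightarrow> mass \<mu>) at_bot"
    using slope_limits[OF * call_at_top[OF \<mu>] call_at_bot[OF \<mu>]] by simp_all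
qed

lemma summands_first_moment:
  assumes "add_measure \<mu> \<nu> \<in> \<M>" and \<mu>: "finite_measure \<mu>" "sets \<mu> = sets borel"
    and \<nu>: "finite_measure \<nu>" "sets \<nu> = sets borel"
  shows "\<mu> \<in> \<M>" "\<nu> \<in> \<M>"
proof -
  have eq: "sets \<nu> = sets \<mu>" using \<mu>(2) \<nu>(2) by (rule trans[OF _ sym, rotated])
  have m: "(\<lambda>x. ennreal \<bar>x\<bar>) \<in> borel_measurable \<mu>"
    unfolding measurable_cong_sets[OF \<mu>(2) refl] by measurable
  have "(\<integral>\<^sup>+x. ennreal \<bar>x\<bar> \<partial>add_measure \<mu> \<nu>) < \<infinity>"
    using first_momentD(3)[OF assms(1)] by (simp add: integrable_iff_bounded)
  then have fin: "(\<integral>\<^sup>+x. ennreal \<bar>x\<bar> \<partial>\<mu>) < \<infinity>" "(\<integral>\<^sup>+x. ennreal \<bar>x\<bar> \<partial>\<nu>) < \<infinity>"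
    unfolding nn_integral_add_measure[OF eq m] by simp_all
  have "(\<lambda>x. \<bar>x\<bar>) \<in> borel_measurable \<kappa>" if "sets \<kappa> = sets borel" for \<kappa> :: "real measure"
    unfolding measurable_cong_sets[OF that refl] by measurable
  then have "integrable \<mu> (\<lambda>x. \<bar>x\<bar>)" "integrable \<nu> (\<lambda>x. \<bar>x\<bar>)"
    using fin \<mu>(2) \<nu>(2) by (simp_all add: integrable_iff_bounded)
  with \<mu> \<nu> show "\<mu> \<in> \<M>" "\<nu> \<in> \<M>"
    by (blast intro: first_momentI)+
qed

text \<open>
  The top part consists of the largest values of $\nu$, up to total mass $m$; an atom at the threshold is
  divided between the two parts. Prescribing the tails avoids choosing a threshold.
\<close>

lemma split_top_bottom:
  assumes \<nu>: "\<nu> \<in> \<M>" and m: "0 \<le> m" "m \<le> mass \<nu>"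
  obtains top bot where "top \<in> \<M>" "bot \<in> \<M>" "\<nu> = add_measure top bot" "mass top = m"
    "\<And>k. tail top k = min (tail \<nu> k) m" "\<And>k. tail bot k = max (tail \<nu> k - m) 0"
proof -
  note anti = antimonoD[OF tail_antimono[OF \<nu>]]
  note lims = tail_limits[OF \<nu>] and rc = tail_continuous_at_right[OF \<nu>]
  have "antimono (\<lambda>k. min (tail \<nu> k) m)"
    by (rule antimonoI) (use anti in \<open>fastforce simp: min_def\<close>)
  moreover have "((\<lambda>k. min (tail \<nu> k) m) \<longlongrightarrow> 0) at_top" "((\<lambda>k. min (tail \<nu> k) m) \<longlongrightarrow> m) at_bot"
    using tendsto_min[OF lims(1) tendsto_const[of m]] tendsto_min[OF lims(2) tendsto_const[of m]] m by simp_all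
  ultimately obtain top where top: "finite_measure top" "sets top = sets borel" "mass top = m"
      "\<And>k. tail top k = min (tail \<nu> k) m"
    using measure_of_tail[of "\<lambda>k. min (tail \<nu> k) m" m] continuous_min[OF rc continuous_const] by metis
  have "antimono (\<lambda>k. max (tail \<nu> k - m) 0)"
    by (rule antimonoI) (use anti in \<open>fastforce simp: max_def\<close>)
  moreover have "((\<lambda>k. max (tail \<nu> k - m) 0) \<longlongrightarrow> 0) at_top" "((\<lambda>k. max (tail \<nu> k - m) 0) \<longlongrightarrow> mass \<nu> - m) at_bot"
    using tendsto_max[OF tendsto_diff[OF lims(1) tendsto_const[of m]] tendsto_const[of 0]]
      tendsto_max[OF tendsto_diff[OF lims(2) tendsto_const[of m]] tendsto_const[of 0]] m by simp_all
  ultimately obtain bot where bot: "finite_measure bot" "sets bot = sets borel"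
      "\<And>k. tail bot k = max (tail \<nu> k - m) 0"
    using measure_of_tail[of "\<lambda>k. max (tail \<nu> k - m) 0" "mass \<nu> - m"]
      continuous_max[OF continuous_diff[OF rc continuous_const] continuous_const] by metis
  have eq: "\<nu> = add_measure top bot"
  proof (rule measure_eq_of_tail_eq)
    show "tail \<nu> k = tail (add_measure top bot) k" for k
      using add_measure_finite(2)[OF top(1,2) bot(1,2), of "{k<..}"] by (simp add: top(4) bot(3))
    show "sets (add_measure top bot) = sets borel" using top(2) by (simp only: sets_add_measure)
  qed (use first_momentD[OF \<nu>] add_measure_finite(1)[OF top(1,2) bot(1,2)] in simp_all)
  with summands_first_moment[OF _ top(1,2) bot(1,2)] \<nu> have "top \<in> \<M>" "bot \<in> \<M>" by simp_all
  with that eq top(3,4) bot(3) show thesis by blast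
qed

text \<open>
  The tail of $\mu$ is at most its mass and at most the tail of $\nu$, hence at most the tail of the top part
  of $\nu$ with the mass of $\mu$. The bottom part serves as the measure that is added.
\<close>

lemma preceq_Nonneg_Sto_factor:
  assumes \<mu>: "\<mu> \<in> \<M>" and \<nu>: "\<nu> \<in> \<M>" and le: "preceq {Nonneg, Sto} \<mu> \<nu>"
  shows "\<exists>\<sigma>\<in>\<M>. preceq {Nonneg} \<mu> \<sigma> \<and> preceq {Sto} \<sigma> \<nu>"
    and "\<exists>\<sigma>\<in>\<M>. preceq {Sto} \<mu> \<sigma> \<and> preceq {Nonneg} \<sigma> \<nu>"
proof -
  interpret \<mu>: finite_measure \<mu> by (rule first_momentD[OF \<mu>])
  have tail: "tail \<mu> k \<le> tail \<nu> k" for k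
    by (rule preceq_tail_le[OF \<mu> \<nu> le]) simp
  have tail_mass: "tail \<mu> k \<le> mass \<mu>" for k
    using \<mu>.bounded_measure first_momentD(4)[OF \<mu>] by simp
  obtain top bot where top: "top \<in> \<M>" "mass top = mass \<mu>" "\<And>k. tail top k = min (tail \<nu> k) (mass \<mu>)"
    and bot: "bot \<in> \<M>" "\<And>k. tail bot k = max (tail \<nu> k - mass \<mu>) 0" and eq: "\<nu> = add_measure top bot"
    using split_top_bottom[OF \<nu> measure_nonneg preceq_mass_le[OF \<mu> \<nu> le]] by metis
  have "preceq {Sto} (add_measure \<mu> bot) \<nu>"
  proof (rule preceq_StoI)
    show "mass (add_measure \<mu> bot) = mass \<nu>"
      by (simp add: eq add_measure_first_moment \<mu> bot(1) top(1,2))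
    show "tail (add_measure \<mu> bot) k \<le> tail \<nu> k" for k
      using tail[of k] tail_mass[of k] by (simp add: add_measure_first_moment(4)[OF \<mu> bot(1)] bot(2))
  qed (use \<nu> \<mu> bot add_measure_first_moment in auto)
  then show "\<exists>\<sigma>\<in>\<M>. preceq {Nonneg} \<mu> \<sigma> \<and> preceq {Sto} \<sigma> \<nu>"
    using preceq_Nonneg_add_measure[OF \<mu> bot(1)] add_measure_first_moment(1)[OF \<mu> bot(1)] by blast
  have "preceq {Sto} \<mu> top"
    by (rule preceq_StoI) (use \<mu> top tail tail_mass in auto)
  moreover have "preceq {Nonneg} top \<nu>"
    unfolding eq by (rule preceq_Nonneg_add_measure[OF top(1) bot(1)])
  ultimately show "\<exists>\<sigma>\<in>\<M>. preceq {Sto} \<mu> \<sigma> \<and> preceq {Nonneg} \<sigma> \<nu>"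
    using top(1) by blast
qed

lemma call_diff_limits:
  assumes \<mu>: "\<mu> \<in> \<M>" and \<nu>: "\<nu> \<in> \<M>"
  shows "((\<lambda>k. call \<nu> k - call \<mu> k) \<longlongrightarrow> 0) at_top"
    and "((\<lambda>k. call \<nu> k - call \<mu> k + (mass \<nu> - mass \<mu>) * k) \<longlongrightarrow> mean \<nu> - mean \<mu>) at_bot"
proof -
  show "((\<lambda>k. call \<nu> k - call \<mu> k) \<longlongrightarrow> 0) at_top"
    using tendsto_diff[OF call_at_top[OF \<nu>] call_at_top[OF \<mu>]] by simp
  show "((\<lambda>k. call \<nu> k - call \<mu> k + (mass \<nu> - mass \<mu>) * k) \<longlongrightarrow> mean \<nu> - mean \<mu>) at_bot"
    using tendsto_diff[OF call_at_bot[OF \<nu>] call_at_bot[OF \<mu>]] by (simp add: algebra_simps)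
qed

text \<open>
  At $+\infty$ the function $H$ lies between $0$ and the difference of the call functions, which tends to $0$.
  At $-\infty$ the other lower bound is the asymptote of that difference. So $H$ has the asymptotics of a call function.
\<close>

lemma measure_of_call_sandwich:
  assumes \<mu>: "\<mu> \<in> \<M>" and \<nu>: "\<nu> \<in> \<M>" and H: "convex_on UNIV H"
    and lower: "\<And>k. max 0 (mean \<nu> - mean \<mu> - (mass \<nu> - mass \<mu>) * k) \<le> H k"
    and upper: "\<And>k. H k \<le> call \<nu> k - call \<mu> k"
  obtains \<eta> where "\<eta> \<in> \<M>" "mass \<eta> = mass \<nu> - mass \<mu>" "mean \<eta> = mean \<nu> - mean \<mu>" "\<And>k. call \<eta> k = H k"
proof (rule measure_of_call[OF H])
  show "(H \<longlongrightarrow> 0) at_top"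
    by (rule tendsto_sandwich[OF _ _ tendsto_const call_diff_limits(1)[OF \<mu> \<nu>]])
      (use lower upper in auto)
  show "((\<lambda>k. H k + (mass \<nu> - mass \<mu>) * k) \<longlongrightarrow> mean \<nu> - mean \<mu>) at_bot"
  proof (rule tendsto_sandwich[OF _ _ tendsto_const call_diff_limits(2)[OF \<mu> \<nu>]])
    show "\<forall>\<^sub>F k in at_bot. mean \<nu> - mean \<mu> \<le> H k + (mass \<nu> - mass \<mu>) * k"
      using lower by (intro always_eventually allI) (simp add: algebra_simps)
  qed (use upper in simp)
qed (use that in blast)

text \<open>
  Comparing call and put functions gives $W \le D$ for the lower bound $W$ of the sandwich and the
  difference $D$ of the call functions. In the first order the added measure has call function $W$, making it as
  concentrated as possible: a point mass if the masses differ. In the second order the measure removed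
  from $\nu$ has as call function the convex hull of $D$.
\<close>

lemma preceq_Nonneg_Cvx_factor:
  assumes \<mu>: "\<mu> \<in> \<M>" and \<nu>: "\<nu> \<in> \<M>" and le: "preceq {Nonneg, Cvx} \<mu> \<nu>"
  shows "\<exists>\<sigma>\<in>\<M>. preceq {Nonneg} \<mu> \<sigma> \<and> preceq {Cvx} \<sigma> \<nu>"
    and "\<exists>\<sigma>\<in>\<M>. preceq {Cvx} \<mu> \<sigma> \<and> preceq {Nonneg} \<sigma> \<nu>"
proof -
  define W where "W k = max 0 (mean \<nu> - mean \<mu> - (mass \<nu> - mass \<mu>) * k)" for k
  have W: "convex_on UNIV W"
    using convex_on_max[OF convex_on_affine[of 0 0] convex_on_affine[of "mean \<nu> - mean \<mu>" "- (mass \<nu> - mass \<mu>)"]]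
    by (simp add: W_def[abs_def] algebra_simps)
  have W_le: "W k \<le> call \<nu> k - call \<mu> k" for k
    using preceq_call_le[OF le, of k] preceq_put_le[OF \<mu> \<nu> le, of k] by (simp add: W_def algebra_simps)
  show "\<exists>\<sigma>\<in>\<M>. preceq {Nonneg} \<mu> \<sigma> \<and> preceq {Cvx} \<sigma> \<nu>"
  proof -
    obtain \<eta> where \<eta>: "\<eta> \<in> \<M>" "mass \<eta> = mass \<nu> - mass \<mu>" "mean \<eta> = mean \<nu> - mean \<mu>" "\<And>k. call \<eta> k = W k"
      using measure_of_call_sandwich[OF \<mu> \<nu> W _ W_le] W_def by (metis order_refl)
    note add = add_measure_first_moment[OF \<mu> \<eta>(1)]
    have "preceq {Cvx} (add_measure \<mu> \<eta>) \<nu>"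
    proof (rule preceq_CvxI[OF add(1) \<nu>])
      show "call (add_measure \<mu> \<eta>) k \<le> call \<nu> k" for k
        using W_le[of k] by (simp add: add(5) \<eta>(4))
    qed (simp_all add: add \<eta>)
    then show ?thesis using add(1) preceq_Nonneg_add_measure[OF \<mu> \<eta>(1)] by blast
  qed
  show "\<exists>\<sigma>\<in>\<M>. preceq {Cvx} \<mu> \<sigma> \<and> preceq {Nonneg} \<sigma> \<nu>"
  proof -
    obtain H where H: "convex_on UNIV H" "\<And>k. W k \<le> H k" "\<And>k. H k \<le> call \<nu> k - call \<mu> k"
      and compl: "convex_on UNIV (\<lambda>k. call \<nu> k - H k)"
      using complement_of_hull_convex[OF convex_call[OF \<nu>] convex_call[OF \<mu>] W W_le] by blast
    obtain \<eta> where \<eta>: "\<eta> \<in> \<M>" "mass \<eta> = mass \<nu> - mass \<mu>" "mean \<eta> = mean \<nu> - mean \<mu>" "\<And>k. call \<eta> k = H k"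
      using measure_of_call_sandwich[OF \<mu> \<nu> H(1) H(2)[unfolded W_def] H(3)] by blast
    obtain \<sigma> where \<sigma>: "\<sigma> \<in> \<M>" "mass \<sigma> = mass \<mu>" "mean \<sigma> = mean \<mu>" "\<And>k. call \<sigma> k = call \<nu> k - H k"
    proof (rule measure_of_call[OF compl])
      show "((\<lambda>k. call \<nu> k - H k) \<longlongrightarrow> 0) at_top"
        using call_diff_limits(1)[OF \<eta>(1) \<nu>] by (simp add: \<eta>(4))
      show "((\<lambda>k. call \<nu> k - H k + mass \<mu> * k) \<longlongrightarrow> mean \<mu>) at_bot"
        using call_diff_limits(2)[OF \<eta>(1) \<nu>] by (simp add: \<eta>)
    qed (rule that)
    have "preceq {Cvx} \<mu> \<sigma>"
    proof (rule preceq_CvxI[OF \<mu> \<sigma>(1)])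
      show "call \<mu> k \<le> call \<sigma> k" for k using H(3)[of k] by (simp add: \<sigma>(4))
    qed (simp_all add: \<sigma>)
    moreover have "add_measure \<sigma> \<eta> = \<nu>"
      using \<sigma>(1,4) \<eta>(1,4) by (intro measure_eq_of_call_eq \<nu>) (simp_all add: add_measure_first_moment)
    ultimately show ?thesis
      using preceq_Nonneg_add_measure[OF \<sigma>(1) \<eta>(1)] \<sigma>(1) by auto
  qed
qed

text \<open>
  If the means differ, $\sigma$ is the image of $\mu$ under $y \mapsto \max(y, x)$, with $x$ chosen so that $\sigma$
  has the mean of $\nu$. Its call function is that of $\mu$ to the right of $x$, and to the left of $x$ it is the line below the call function
  of $\nu$ given by Jensen's inequality (\<open>call_ge_line\<close>).
\<close>

lemma Sto_Cvx_factor: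
  assumes \<mu>: "\<mu> \<in> \<M>" and \<nu>: "\<nu> \<in> \<M>" and mass: "mass \<mu> = mass \<nu>" and le: "\<And>k. call \<mu> k \<le> call \<nu> k"
  shows "\<exists>\<sigma>\<in>\<M>. preceq {Sto} \<mu> \<sigma> \<and> preceq {Cvx} \<sigma> \<nu>"
proof -
  define C where "C k = max (call \<mu> k) (mean \<nu> - mass \<nu> * k)" for k
  have C: "convex_on UNIV C"
    using convex_on_max[OF convex_call[OF \<mu>] convex_on_affine[of "mean \<nu>" "- mass \<nu>"]]
    by (simp add: C_def[abs_def])
  have C_le: "C k \<le> call \<nu> k" for k
    using le[of k] call_ge_line[OF \<nu>, of k] by (simp add: C_def)
  obtain \<sigma> where \<sigma>: "\<sigma> \<in> \<M>" "mass \<sigma> = mass \<nu>" "mean \<sigma> = mean \<nu>" "\<And>k. call \<sigma> k = C k"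
  proof (rule measure_of_call[OF C])
    show "(C \<longlongrightarrow> 0) at_top"
      by (rule tendsto_sandwich[OF _ _ call_at_top[OF \<mu>] call_at_top[OF \<nu>]])
        (use C_le in \<open>simp_all add: C_def\<close>)
    show "((\<lambda>k. C k + mass \<nu> * k) \<longlongrightarrow> mean \<nu>) at_bot"
    proof (rule tendsto_sandwich[OF _ _ tendsto_const call_at_bot[OF \<nu>]])
      show "\<forall>\<^sub>F k in at_bot. mean \<nu> \<le> C k + mass \<nu> * k"
        by (intro always_eventually allI) (simp add: C_def max_def)
    qed (use C_le in simp)
  qed (rule that)
  have "preceq {Sto} \<mu> \<sigma>"
  proof (rule preceq_StoI[OF \<mu> \<sigma>(1)])
    have "antimono (\<lambda>k. C k - call \<mu> k)"
    proof (rule antimonoI)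
      fix k l :: real assume "k \<le> l"
      then show "C l - call \<mu> l \<le> C k - call \<mu> k"
        using mono_call_plus_line[OF \<mu>, of k l] mass by (simp add: C_def max_def)
    qed
    then show "tail \<mu> k \<le> tail \<sigma> k" for k
      by (intro tail_le_of_call_diff_antimono[OF \<mu> \<sigma>(1)]) (simp add: \<sigma>(4))
  qed (simp add: mass \<sigma>)
  moreover have "preceq {Cvx} \<sigma> \<nu>"
    using \<sigma> C_le by (intro preceq_CvxI \<nu>) auto
  ultimately show ?thesis using \<sigma>(1) by blast
qed

text \<open>
  The difference between the call functions of $\nu$ and $\sigma$ has to be non-increasing and at most
  $D$, the difference for $\nu$ and $\mu$. The running infimum $H$ of $D$ is the largest such function; it has the same limits as
  $D$, so that $\sigma$ gets the mean of $\mu$.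
\<close>

lemma Cvx_Sto_factor:
  assumes \<mu>: "\<mu> \<in> \<M>" and \<nu>: "\<nu> \<in> \<M>" and mass: "mass \<mu> = mass \<nu>" and le: "\<And>k. call \<mu> k \<le> call \<nu> k"
  shows "\<exists>\<sigma>\<in>\<M>. preceq {Cvx} \<mu> \<sigma> \<and> preceq {Sto} \<sigma> \<nu>"
proof -
  define H where "H x = (INF y\<in>{..x}. call \<nu> y - call \<mu> y)" for x
  have bdd: "bdd_below ((\<lambda>y. call \<nu> y - call \<mu> y) ` A)" for A
    by (rule bdd_belowI[of _ 0]) (use le in auto)
  have H_le: "H x \<le> call \<nu> y - call \<mu> y" if "y \<le> x" for x y
    unfolding H_def by (rule cINF_lower[OF bdd]) (use that in simp)
  have H_ge: "c \<le> H x" if "\<And>y. y \<le> x \<Longrightarrow> c \<le> call \<nu> y - call \<mu> y" for c x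
    unfolding H_def using that by (intro cINF_greatest) auto
  have C: "convex_on UNIV (\<lambda>k. call \<nu> k - H k)"
    unfolding H_def by (rule complement_of_running_infimum_convex[OF convex_call[OF \<nu>] convex_call[OF \<mu>] le])
  have Htop: "(H \<longlongrightarrow> 0) at_top"
    by (rule tendsto_sandwich[OF _ _ tendsto_const call_diff_limits(1)[OF \<mu> \<nu>]])
      (use H_le H_ge[of _ 0] le in auto)
  have D: "((\<lambda>k. call \<nu> k - call \<mu> k) \<longlongrightarrow> mean \<nu> - mean \<mu>) at_bot"
    using call_diff_limits(2)[OF \<mu> \<nu>] by (simp add: mass)
  have Hbot: "(H \<longlongrightarrow> mean \<nu> - mean \<mu>) at_bot"
  proof (rule order_tendstoI)
    fix c assume "c < mean \<nu> - mean \<mu>"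
    then obtain c' where c': "c < c'" "c' < mean \<nu> - mean \<mu>" using dense by blast
    obtain N where "\<And>y. y \<le> N \<Longrightarrow> c' < call \<nu> y - call \<mu> y"
      using order_tendstoD(1)[OF D c'(2)] by (auto simp: eventually_at_bot_linorder)
    then have "c < H x" if "x \<le> N" for x
      using that c'(1) by (intro less_le_trans[OF c'(1)] H_ge) (force intro: less_imp_le)
    then show "\<forall>\<^sub>F x in at_bot. c < H x" by (auto simp: eventually_at_bot_linorder)
  next
    fix c assume c: "mean \<nu> - mean \<mu> < c"
    show "\<forall>\<^sub>F x in at_bot. H x < c"
      using order_tendstoD(2)[OF D c] by eventually_elim (use H_le le_less_trans in blast)
  qed
  obtain \<sigma> where \<sigma>: "\<sigma> \<in> \<M>" "mass \<sigma> = mass \<nu>" "mean \<sigma> = mean \<mu>" "\<And>k. call \<sigma> k = call \<nu> k - H k"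
  proof (rule measure_of_call[OF C])
    show "((\<lambda>k. call \<nu> k - H k) \<longlongrightarrow> 0) at_top"
      using tendsto_diff[OF call_at_top[OF \<nu>] Htop] by simp
    show "((\<lambda>k. call \<nu> k - H k + mass \<nu> * k) \<longlongrightarrow> mean \<mu>) at_bot"
      using tendsto_diff[OF call_at_bot[OF \<nu>] Hbot] by (simp add: algebra_simps)
  qed (rule that)
  have "preceq {Sto} \<sigma> \<nu>"
  proof (rule preceq_StoI[OF \<sigma>(1) \<nu>])
    have "antimono H"
      by (intro antimonoI H_ge H_le) simp
    then show "tail \<sigma> k \<le> tail \<nu> k" for k
      by (intro tail_le_of_call_diff_antimono[OF \<sigma>(1) \<nu>]) (simp add: \<sigma>(4))
  qed (simp add: \<sigma>)
  moreover have "preceq {Cvx} \<mu> \<sigma>"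
  proof (rule preceq_CvxI[OF \<mu> \<sigma>(1)])
    show "call \<mu> k \<le> call \<sigma> k" for k using H_le[of k k] by (simp add: \<sigma>(4))
  qed (simp_all add: \<sigma> mass)
  ultimately show ?thesis using \<sigma>(1) by blast
qed

section \<open>Commuting factors and the general case\<close>

text \<open>
  At $-\infty$ the difference of the call functions behaves like $\beta - \delta k$ for the differences $\beta$ of
  the means and $\delta$ of the masses. A mass $\delta$ placed at $x$ changes the call function by
  $\delta (x - k)^+$, which stays below that as soon as $\delta x < \beta$ and $x$ is in the range of the asymptotics.
\<close>

lemma add_mass_far_left:
  assumes \<mu>: "\<mu> \<in> \<M>" and \<nu>: "\<nu> \<in> \<M>" and mass: "mass \<mu> \<le> mass \<nu>" and le: "\<And>k. call \<mu> k \<le> call \<nu> k"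
  obtains \<sigma> where "\<sigma> \<in> \<M>" "preceq {Nonneg} \<mu> \<sigma>" "mass \<sigma> = mass \<nu>" "\<And>k. call \<sigma> k \<le> call \<nu> k"
proof -
  define \<delta> where "\<delta> = mass \<nu> - mass \<mu>"
  have \<delta>: "0 \<le> \<delta>" using mass by (simp add: \<delta>_def)
  have "mean \<nu> - mean \<mu> - 1 < mean \<nu> - mean \<mu>" by simp
  from order_tendstoD(1)[OF call_diff_limits(2)[OF \<mu> \<nu>] this]
  obtain K where K: "mean \<nu> - mean \<mu> - 1 < call \<nu> k - call \<mu> k + \<delta> * k" if "k \<le> K" for k
    by (auto simp: eventually_at_bot_linorder \<delta>_def)
  \<comment> \<open>If $\delta = 0$ the quotient is $0$, and any position serves.\<close>
  define x where "x = min K ((mean \<nu> - mean \<mu> - 1) / \<delta>)"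
  have \<delta>x: "\<delta> * x \<le> mean \<nu> - mean \<mu> - 1" if "\<delta> \<noteq> 0"
  proof -
    have "\<delta> * x \<le> \<delta> * ((mean \<nu> - mean \<mu> - 1) / \<delta>)"
      using \<delta> by (intro mult_left_mono) (auto simp: x_def)
    then show ?thesis using that by simp
  qed
  define H where "H k = \<delta> * max (x - k) 0" for k
  have H_le: "H k \<le> call \<nu> k - call \<mu> k" for k
  proof (cases "\<delta> \<noteq> 0 \<and> k < x")
    case True
    then have "k \<le> K" by (simp add: x_def)
    then show ?thesis using K[of k] \<delta>x True by (simp add: H_def algebra_simps)
  next
    case False
    then have "H k = 0" by (auto simp: H_def)
    then show ?thesis using le[of k] by simp
  qed
  have H: "convex_on UNIV H"
    using convex_on_cmul[OF \<delta> convex_on_hockey_stick(2)[of x]] by (simp add: H_def[abs_def])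
  obtain \<eta> where \<eta>: "\<eta> \<in> \<M>" "mass \<eta> = \<delta>" "\<And>k. call \<eta> k = H k"
  proof (rule measure_of_call[OF H])
    show "(H \<longlongrightarrow> 0) at_top"
      by (intro tendsto_eventually eventually_mono[OF eventually_ge_at_top[of x]]) (simp add: H_def)
    show "((\<lambda>k. H k + \<delta> * k) \<longlongrightarrow> \<delta> * x) at_bot"
      by (intro tendsto_eventually eventually_mono[OF eventually_le_at_bot[of x]])
        (simp add: H_def algebra_simps)
  qed (use that in blast)
  note add = add_measure_first_moment[OF \<mu> \<eta>(1)]
  show thesis
  proof (rule that)
    show "preceq {Nonneg} \<mu> (add_measure \<mu> \<eta>)" by (rule preceq_Nonneg_add_measure[OF \<mu> \<eta>(1)])
    show "call (add_measure \<mu> \<eta>) k \<le> call \<nu> k" for k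
      using H_le[of k] by (simp add: add(5) \<eta>(3))
  qed (simp_all add: add \<eta>(2) \<delta>_def)
qed

lemma preceq_antimono: "preceq R \<mu> \<nu> \<Longrightarrow> R \<subseteq> R' \<Longrightarrow> preceq R' \<mu> \<nu>"
  by (auto simp: preceq_def)

lemma preceq_trans: "preceq R \<mu> \<nu> \<Longrightarrow> preceq R \<nu> \<rho> \<Longrightarrow> preceq R \<mu> \<rho>"
  by (auto simp: preceq_def intro: order_trans)

lemma preceq_rel_pair:
  assumes "r \<noteq> s"
  shows "preceq_rel {r, s} = preceq_rel {r} O preceq_rel {s}"
proof
  show "preceq_rel {r} O preceq_rel {s} \<subseteq> preceq_rel {r, s}"
    by (auto simp: preceq_rel_def intro: preceq_trans dest: preceq_antimono[of _ _ _ "{r, s}"])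
  show "preceq_rel {r, s} \<subseteq> preceq_rel {r} O preceq_rel {s}"
  proof safe
    fix \<mu> \<nu> assume "(\<mu>, \<nu>) \<in> preceq_rel {r, s}"
    then have \<mu>: "\<mu> \<in> \<M>" and \<nu>: "\<nu> \<in> \<M>" and le: "preceq {r, s} \<mu> \<nu>"
      by (auto simp: preceq_rel_def)
    have "\<exists>\<sigma>\<in>\<M>. preceq {r} \<mu> \<sigma> \<and> preceq {s} \<sigma> \<nu>"
    proof (cases "Nonneg \<in> {r, s}")
      case False
      then have *: "mass \<mu> = mass \<nu>" "\<And>k. call \<mu> k \<le> call \<nu> k"
        using preceq_mass_eq[OF \<mu> \<nu> le] preceq_call_le[OF le] by auto
      show ?thesis
        using Sto_Cvx_factor[OF \<mu> \<nu> *] Cvx_Sto_factor[OF \<mu> \<nu> *] assms False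
        by (cases r; cases s) auto
    next
      case True
      then show ?thesis
        using preceq_Nonneg_Sto_factor[OF \<mu> \<nu>] preceq_Nonneg_Cvx_factor[OF \<mu> \<nu>] assms le
        by (cases r; cases s) (auto simp: insert_commute)
    qed
    then show "(\<mu>, \<nu>) \<in> preceq_rel {r} O preceq_rel {s}"
      using \<mu> \<nu> by (auto simp: preceq_rel_def)
  qed
qed

lemma preceq_rel_commute: "preceq_rel {r} O preceq_rel {s} = preceq_rel {s} O preceq_rel {r}"
  using preceq_rel_pair[of r s] preceq_rel_pair[of s r] by (cases "r = s") (auto simp: insert_commute)

text \<open>
  The three relations commute, so a factorization in one order gives all of them.
\<close>

lemma preceq_rel_UNIV_factor:
  assumes "r \<noteq> s" "s \<noteq> t" "r \<noteq> t"
  shows "preceq_rel UNIV \<subseteq> preceq_rel {r} O preceq_rel {s} O preceq_rel {t}"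
proof -
  have left_commute: "preceq_rel {r} O (preceq_rel {s} O X) = preceq_rel {s} O (preceq_rel {r} O X)" for r s X
    by (simp only: O_assoc[symmetric] preceq_rel_commute[of r s])
  have "preceq_rel UNIV \<subseteq> preceq_rel {Nonneg} O preceq_rel {Sto} O preceq_rel {Cvx}"
  proof safe
    fix \<mu> \<nu> assume "(\<mu>, \<nu>) \<in> preceq_rel UNIV"
    then have \<mu>: "\<mu> \<in> \<M>" and \<nu>: "\<nu> \<in> \<M>" and le: "preceq UNIV \<mu> \<nu>"
      by (auto simp: preceq_rel_def)
    obtain \<sigma> where \<sigma>: "\<sigma> \<in> \<M>" "preceq {Nonneg} \<mu> \<sigma>" "mass \<sigma> = mass \<nu>" "\<And>k. call \<sigma> k \<le> call \<nu> k"
      using add_mass_far_left[OF \<mu> \<nu> preceq_mass_le[OF \<mu> \<nu> le] preceq_call_le[OF le]] by blast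
    obtain \<tau> where "\<tau> \<in> \<M>" "preceq {Sto} \<sigma> \<tau>" "preceq {Cvx} \<tau> \<nu>"
      using Sto_Cvx_factor[OF \<sigma>(1) \<nu> \<sigma>(3,4)] by blast
    with \<mu> \<nu> \<sigma> show "(\<mu>, \<nu>) \<in> preceq_rel {Nonneg} O preceq_rel {Sto} O preceq_rel {Cvx}"
      by (auto simp: preceq_rel_def)
  qed
  then show ?thesis
    using assms by (cases r; cases s; cases t) (simp_all add: preceq_rel_commute left_commute)
qed

lemma antisym_preceq_rel: "antisym (preceq_rel R)"
proof (rule antisymI)
  fix \<mu> \<nu> assume "(\<mu>, \<nu>) \<in> preceq_rel R" "(\<nu>, \<mu>) \<in> preceq_rel R"
  then show "\<mu> = \<nu>"
    by (intro measure_eq_of_call_eq antisym preceq_call_le) (auto simp: preceq_rel_def)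
qed

lemma trans_preceq_rel: "trans (preceq_rel R)"
  by (rule transI) (auto simp: preceq_rel_def intro: preceq_trans)

lemma partial_order_preceq_rel: "partial_order_on \<M> (preceq_rel R)"
  by (auto simp: partial_order_on_def preorder_on_def refl_on_def antisym_preceq_rel trans_preceq_rel)
    (auto simp: preceq_rel_def preceq_def)

lemma preceq_chain:
  fixes r :: "nat \<Rightarrow> order_kind"
  assumes "\<And>i. i \<in> {1..n} \<Longrightarrow> preceq {r i} (\<mu> (i - 1)) (\<mu> i)"
  shows "preceq (r ` {1..n}) (\<mu> 0) (\<mu> n)"
  using assms
proof (induction n)
  case 0
  then show ?case by (simp add: preceq_def)
next
  case (Suc n)
  have "preceq (r ` {1..n}) (\<mu> 0) (\<mu> n)"
    by (rule Suc.IH, rule Suc.prems) simp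
  moreover have "preceq {r (Suc n)} (\<mu> n) (\<mu> (Suc n))"
    using Suc.prems[of "Suc n"] by simp
  moreover have "r ` {1..n} \<subseteq> r ` {1..Suc n}" "{r (Suc n)} \<subseteq> r ` {1..Suc n}"
    by auto
  ultimately show ?case by (blast intro: preceq_trans preceq_antimono)
qed

lemma preceq_interpolate:
  assumes n: "n \<in> {2, 3}" and inj: "inj_on r {1..n}"
    and \<mu>0: "\<mu>0 \<in> \<M>" and \<mu>n: "\<mu>n \<in> \<M>" and le: "preceq (r ` {1..n}) \<mu>0 \<mu>n"
  shows "\<exists>\<mu> :: nat \<Rightarrow> real measure. \<mu> 0 = \<mu>0 \<and> \<mu> n = \<mu>n \<and> (\<forall>i\<in>{0..n}. \<mu> i \<in> \<M>) \<and>
    (\<forall>i\<in>{1..n}. preceq {r i} (\<mu> (i - 1)) (\<mu> i))"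
proof (cases "n = 2")
  case True
  have [simp]: "{Suc 0..2} = {Suc 0, 2}" "{0..2} = {0, 1, 2 :: nat}" by auto
  have "r 1 \<noteq> r 2" using inj True by auto
  moreover have "(\<mu>0, \<mu>n) \<in> preceq_rel {r 1, r 2}"
    using True le \<mu>0 \<mu>n by (simp add: preceq_rel_def)
  ultimately have "(\<mu>0, \<mu>n) \<in> preceq_rel {r 1} O preceq_rel {r 2}"
    using preceq_rel_pair by blast
  then obtain \<sigma> where "\<sigma> \<in> \<M>" "preceq {r 1} \<mu>0 \<sigma>" "preceq {r 2} \<sigma> \<mu>n"
    by (auto simp: preceq_rel_def)
  then show ?thesis
    using \<mu>0 \<mu>n True by (intro exI[of _ "(!) [\<mu>0, \<sigma>, \<mu>n]"]) simp
next
  case False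
  then have n: "n = 3" using n by simp
  have [simp]: "{Suc 0..3} = {Suc 0, 2, 3}" "{0..3} = {0, 1, 2, 3 :: nat}" by auto
  have r: "r 1 \<noteq> r 2" "r 2 \<noteq> r 3" "r 1 \<noteq> r 3"
    using inj n by auto
  then have "(\<mu>0, \<mu>n) \<in> preceq_rel {r 1} O preceq_rel {r 2} O preceq_rel {r 3}"
    using preceq_rel_UNIV_factor[OF r] preceq_antimono[OF le subset_UNIV] \<mu>0 \<mu>n
    by (auto simp: preceq_rel_def)
  then obtain \<sigma> \<tau> where "\<sigma> \<in> \<M>" "\<tau> \<in> \<M>" "preceq {r 1} \<mu>0 \<sigma>" "preceq {r 2} \<sigma> \<tau>" "preceq {r 3} \<tau> \<mu>n"
    by (auto simp: preceq_rel_def)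
  moreover have "[\<mu>0, \<sigma>, \<tau>, \<mu>n] ! 2 = \<tau>" "[\<mu>0, \<sigma>, \<tau>, \<mu>n] ! 3 = \<mu>n"
    by (simp_all add: numeral_eq_Suc)
  ultimately show ?thesis
    using \<mu>0 \<mu>n n by (intro exI[of _ "(!) [\<mu>0, \<sigma>, \<tau>, \<mu>n]"]) simp
qed

theorem theorem1p8:
  shows "(\<forall>R. R \<noteq> {} \<longrightarrow>
            antisym (preceq_rel R) \<and> trans (preceq_rel R) \<and> partial_order_on \<M> (preceq_rel R))
       \<and> (\<forall>(n::nat) (r :: nat \<Rightarrow> order_kind). n \<in> {2, 3} \<and> inj_on r {1..n} \<longrightarrow>
            (\<forall>\<mu> :: nat \<Rightarrow> real measure.
               (\<forall>i\<in>{0..n}. \<mu> i \<in> \<M>) \<and> (\<forall>i\<in>{1..n}. preceq {r i} (\<mu> (i - 1)) (\<mu> i))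
               \<longrightarrow> preceq (r ` {1..n}) (\<mu> 0) (\<mu> n))
          \<and> (\<forall>\<mu>\<^sub>0\<in>\<M>. \<forall>\<mu>\<^sub>n\<in>\<M>. preceq (r ` {1..n}) \<mu>\<^sub>0 \<mu>\<^sub>n \<longrightarrow>
               (\<exists>\<mu> :: nat \<Rightarrow> real measure.
                  \<mu> 0 = \<mu>\<^sub>0 \<and> \<mu> n = \<mu>\<^sub>n \<and> (\<forall>i\<in>{0..n}. \<mu> i \<in> \<M>) \<and>
                  (\<forall>i\<in>{1..n}. preceq {r i} (\<mu> (i - 1)) (\<mu> i)))))"
proof (intro conjI allI impI ballI; (elim conjE)?)
qed (blast intro: antisym_preceq_rel trans_preceq_rel partial_order_preceq_rel preceq_chain preceq_interpolate)+

end
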